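(* Let $R$ be a commutative ring with global dimension $\mathrm{gldim}(R)=m$ for some integer $m\geq 1$, such that $R$ contains a non-zero divisor element $x$. Then the quotient ring $R/xR$ is $(2,m-1)$-SG.
   Context: All rings are associative with identity. $\mathrm{pd}$ denotes projective dimension. For integers $n\ge1$, $k\ge0$, a module $M$ over a ring $S$ is $(n,k)$-SG-projective if there is an exact sequence of $S$-modules $0\to M\to Q_n\to\cdots\to Q_1\to M\to 0$ with $\mathrm{pd}_S(Q_i)\le k$ for $1\le i\le n$, and $\mathrm{Ext}^i_S(M,Q)=0$ for every $i>k$ and every projective $S$-module $Q$. A ring $S$ is left (resp. right) $(n,k)$-SG if every left (resp. right) $S$-module is $(n,k)$-SG-projective, and $(n,k)$-SG if it is both left and right $(n,k)$-SG; for a commutative ring $S$ this just means that every $S$-module is $(n,k)$-SG-projective. *)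

theory Defs
  imports "HOL-Algebra.Algebra" "HOL-Library.Extended_Nat" "HOL-Library.Equipollence"
begin

text \<open>
  HOL cannot quantify over modules on all types inside a formula.  Throughout, the modules range
  over all modules whose carrier is a subset of one type \<open>'u\<close>, which plays the role of the universe
  and is passed as \<open>TYPE('u)\<close> where no argument determines it.  The notions below have their
  usual meaning for a ring \<open>R\<close> as soon as \<open>'u\<close> is infinite and \<open>carrier R \<lesssim> (UNIV :: 'u set)\<close>: then
  every module on \<open>'u\<close> has a free resolution on \<open>'u\<close>, and every cyclic module has a copy on \<open>'u\<close>.

  The locale \<open>module\<close> contains the assumption that the base ring is commutative.
\<close>

definition module_hom ::
    "('a, 'c) ring_scheme \<Rightarrow> ('a, 'b) module \<Rightarrow> ('a, 'd) module \<Rightarrow> ('b \<Rightarrow> 'd) set" where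
  "module_hom R M N = {f \<in> hom (add_monoid M) (add_monoid N).
     \<forall>a\<in>carrier R. \<forall>x\<in>carrier M. f (a \<odot>\<^bsub>M\<^esub> x) = a \<odot>\<^bsub>N\<^esub> f x}"

definition projective_module :: "('a, 'c) ring_scheme \<Rightarrow> ('a, 'u) module \<Rightarrow> bool" where
  "projective_module R P \<longleftrightarrow> module R P \<and>
     (\<forall>(A :: ('a, 'u) module) (B :: ('a, 'u) module). \<forall>g f.
        module R A \<longrightarrow> module R B \<longrightarrow>
        g \<in> module_hom R A B \<longrightarrow> g ` carrier A = carrier B \<longrightarrow> f \<in> module_hom R P B \<longrightarrow>
        (\<exists>h\<in>module_hom R P A. \<forall>x\<in>carrier P. g (h x) = f x))"

text \<open>
  The resolution \<open>\<dots> \<longrightarrow> P 1 \<longrightarrow> P 0 \<longrightarrow> M \<longrightarrow> 0\<close>; here \<open>d 0 : P 0 \<longrightarrow> M\<close> is the augmentation and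
  \<open>d (Suc i) : P (Suc i) \<longrightarrow> P i\<close>.
\<close>

definition projective_resolution ::
    "('a, 'c) ring_scheme \<Rightarrow> ('a, 'u) module \<Rightarrow> (nat \<Rightarrow> ('a, 'u) module) \<Rightarrow> (nat \<Rightarrow> 'u \<Rightarrow> 'u) \<Rightarrow> bool" where
  "projective_resolution R M P d \<longleftrightarrow>
     (\<forall>i. projective_module R (P i)) \<and>
     d 0 \<in> module_hom R (P 0) M \<and> (\<forall>i. d (Suc i) \<in> module_hom R (P (Suc i)) (P i)) \<and>
     d 0 ` carrier (P 0) = carrier M \<and>
     d 1 ` carrier (P 1) = a_kernel (P 0) M (d 0) \<and>
     (\<forall>i. d (Suc (Suc i)) ` carrier (P (Suc (Suc i))) = a_kernel (P (Suc i)) (P i) (d (Suc i)))"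

text \<open>The infimum of the empty set is \<open>\<infinity>\<close>; the zero module gets dimension \<open>0\<close>.\<close>

definition proj_dim :: "('a, 'c) ring_scheme \<Rightarrow> ('a, 'u) module \<Rightarrow> enat" where
  "proj_dim R M = Inf {enat n | n. \<exists>P d. projective_resolution R M P d \<and>
                                    (\<forall>i>n. carrier (P i) = {\<zero>\<^bsub>P i\<^esub>})}"

definition gl_dim :: "'u itself \<Rightarrow> ('a, 'c) ring_scheme \<Rightarrow> enat" where
  "gl_dim _ R = Sup {proj_dim R M | M :: ('a, 'u) module. module R M}"

text \<open>
  Elements of the group \<open>Hom\<close> are extensional functions, so that homomorphisms agreeing on the
  carrier are equal.
\<close>

definition Hom_group ::
    "('a, 'c) ring_scheme \<Rightarrow> ('a, 'b) module \<Rightarrow> ('a, 'd) module \<Rightarrow> ('b \<Rightarrow> 'd) monoid" where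
  "Hom_group R M N = \<lparr>carrier = module_hom R M N \<inter> extensional (carrier M),
     monoid.mult = (\<lambda>f g. \<lambda>x\<in>carrier M. f x \<oplus>\<^bsub>N\<^esub> g x),
     one = (\<lambda>x\<in>carrier M. \<zero>\<^bsub>N\<^esub>)\<rparr>"

text \<open>
  Cohomology in degree \<open>i\<close> of \<open>0 \<longrightarrow> Hom (P 0) N \<longrightarrow> Hom (P 1) N \<longrightarrow> \<dots>\<close>, with \<open>M\<close> deleted.
\<close>

definition Ext_cocycles ::
    "('a, 'c) ring_scheme \<Rightarrow> (nat \<Rightarrow> ('a, 'b) module) \<Rightarrow> (nat \<Rightarrow> 'b \<Rightarrow> 'b) \<Rightarrow> nat \<Rightarrow> ('a, 'd) module \<Rightarrow> ('b \<Rightarrow> 'd) set" where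
  "Ext_cocycles R P d i N = {f \<in> carrier (Hom_group R (P i) N).
     compose (carrier (P (Suc i))) f (d (Suc i)) = \<one>\<^bsub>Hom_group R (P (Suc i)) N\<^esub>}"

definition Ext_coboundaries ::
    "('a, 'c) ring_scheme \<Rightarrow> (nat \<Rightarrow> ('a, 'b) module) \<Rightarrow> (nat \<Rightarrow> 'b \<Rightarrow> 'b) \<Rightarrow> nat \<Rightarrow> ('a, 'd) module \<Rightarrow> ('b \<Rightarrow> 'd) set" where
  "Ext_coboundaries R P d i N = (case i of
       0 \<Rightarrow> {\<one>\<^bsub>Hom_group R (P 0) N\<^esub>}
     | Suc j \<Rightarrow> (\<lambda>g. compose (carrier (P (Suc j))) g (d (Suc j))) ` carrier (Hom_group R (P j) N))"

definition Ext ::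
    "('a, 'c) ring_scheme \<Rightarrow> nat \<Rightarrow> ('a, 'u) module \<Rightarrow> ('a, 'd) module \<Rightarrow> ('u \<Rightarrow> 'd) set monoid" where
  "Ext R i M N = (let (P, d) = SOME (P, d). projective_resolution R M P d in
     (Hom_group R (P i) N)\<lparr>carrier := Ext_cocycles R P d i N\<rparr> Mod Ext_coboundaries R P d i N)"

text \<open>
  In the exact sequence \<open>0 \<longrightarrow> M \<longrightarrow> Q n \<longrightarrow> \<dots> \<longrightarrow> Q 1 \<longrightarrow> M \<longrightarrow> 0\<close> both copies of \<open>M\<close> are written as terms of
  the sequence, \<open>Q 0 = M\<close> and \<open>Q (Suc n) = M\<close>, with \<open>f i : Q (Suc i) \<longrightarrow> Q i\<close> for \<open>i \<le> n\<close>.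
\<close>

definition SG_projective :: "nat \<Rightarrow> nat \<Rightarrow> ('a, 'c) ring_scheme \<Rightarrow> ('a, 'u) module \<Rightarrow> bool" where
  "SG_projective n k S M \<longleftrightarrow> 1 \<le> n \<and> module S M \<and>
     (\<exists>(Q :: nat \<Rightarrow> ('a, 'u) module) f.
        Q 0 = M \<and> Q (Suc n) = M \<and>
        (\<forall>i\<in>{1..n}. module S (Q i) \<and> proj_dim S (Q i) \<le> enat k) \<and>
        (\<forall>i\<le>n. f i \<in> module_hom S (Q (Suc i)) (Q i)) \<and>
        inj_on (f n) (carrier (Q (Suc n))) \<and>
        (\<forall>i<n. f (Suc i) ` carrier (Q (Suc (Suc i))) = a_kernel (Q (Suc i)) (Q i) (f i)) \<and>
        f 0 ` carrier (Q 1) = carrier (Q 0)) \<and>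
     (\<forall>i>k. \<forall>Q :: ('a, 'u) module. projective_module S Q \<longrightarrow> trivial_group (Ext S i M Q))"

definition SG_ring :: "'u itself \<Rightarrow> nat \<Rightarrow> nat \<Rightarrow> ('a, 'c) ring_scheme \<Rightarrow> bool" where
  "SG_ring _ n k S \<longleftrightarrow> cring S \<and> (\<forall>M :: ('a, 'u) module. module S M \<longrightarrow> SG_projective n k S M)"

definition non_zero_divisor :: "('a, 'c) ring_scheme \<Rightarrow> 'a \<Rightarrow> bool" where
  "non_zero_divisor R x \<longleftrightarrow> x \<in> carrier R \<and>
     (\<forall>y\<in>carrier R. x \<otimes>\<^bsub>R\<^esub> y = \<zero>\<^bsub>R\<^esub> \<longrightarrow> y = \<zero>\<^bsub>R\<^esub>)"

end

theory Submission
  imports Defs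
begin

text \<open>
  Write \<open>S = R / x R\<close>. For an \<open>S\<close>-module \<open>M\<close>, take a projective resolution
  \<open>\<dots> \<longrightarrow> P 1 \<longrightarrow> P 0 \<longrightarrow> M\<close> over \<open>R\<close> of length at most \<open>m\<close>, and let \<open>K\<close> be the kernel of
  \<open>P 0 \<longrightarrow> M\<close>. As \<open>x\<close> kills \<open>M\<close> and acts injectively on \<open>P 0\<close>, multiplication by \<open>x\<close> induces
  \<open>M \<cong> P 0 / K \<cong> x P 0 / x K\<close>, which gives the exact sequence
  \<open>0 \<longrightarrow> M \<longrightarrow> K / x K \<longrightarrow> P 0 / x P 0 \<longrightarrow> M \<longrightarrow> 0\<close>. Reducing the shifted resolution of \<open>K\<close> modulo \<open>x\<close>
  resolves \<open>K / x K\<close> over \<open>S\<close> in length \<open>m - 1\<close>.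

  For the vanishing of \<open>Ext\<close>, projective \<open>S\<close>-modules have projective dimension at most one over \<open>R\<close>,
  so each syzygy over \<open>S\<close> lowers the projective dimension over \<open>R\<close> until it reaches one. If
  \<open>0 \<longrightarrow> K \<longrightarrow> P \<longrightarrow> C \<longrightarrow> 0\<close> is a resolution over \<open>R\<close> of such a syzygy \<open>C\<close> and \<open>F\<close> is projective over
  \<open>R\<close>, then a map \<open>K / x P \<longrightarrow> F / x F\<close> lifts to \<open>k : K \<longrightarrow> F\<close> with \<open>k (x P) \<subseteq> x F\<close>, and
  \<open>p \<mapsto> k (x p) / x\<close> extends it to \<open>P / x P\<close>. Hence \<open>Ext\<^sub>S\<^sup>1 (C, F / x F) = 0\<close>, and every projective
  \<open>S\<close>-module is a direct summand of some \<open>F / x F\<close>.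
\<close>

section \<open>Module homomorphisms, quotients and direct sums\<close>

lemma module_hom_iff:
  "f \<in> module_hom R M N \<longleftrightarrow>
     (\<forall>u\<in>carrier M. f u \<in> carrier N) \<and>
     (\<forall>u\<in>carrier M. \<forall>v\<in>carrier M. f (u \<oplus>\<^bsub>M\<^esub> v) = f u \<oplus>\<^bsub>N\<^esub> f v) \<and>
     (\<forall>a\<in>carrier R. \<forall>u\<in>carrier M. f (a \<odot>\<^bsub>M\<^esub> u) = a \<odot>\<^bsub>N\<^esub> f u)"
  by (auto simp: module_hom_def hom_def Pi_def)

lemma module_homI:
  assumes "\<And>u. u \<in> carrier M \<Longrightarrow> f u \<in> carrier N"
    and "\<And>u v. u \<in> carrier M \<Longrightarrow> v \<in> carrier M \<Longrightarrow> f (u \<oplus>\<^bsub>M\<^esub> v) = f u \<oplus>\<^bsub>N\<^esub> f v"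
    and "\<And>a u. a \<in> carrier R \<Longrightarrow> u \<in> carrier M \<Longrightarrow> f (a \<odot>\<^bsub>M\<^esub> u) = a \<odot>\<^bsub>N\<^esub> f u"
  shows "f \<in> module_hom R M N"
  using assms by (simp add: module_hom_iff)

lemma module_hom_closed: "f \<in> module_hom R M N \<Longrightarrow> u \<in> carrier M \<Longrightarrow> f u \<in> carrier N"
  and module_hom_add: "f \<in> module_hom R M N \<Longrightarrow> u \<in> carrier M \<Longrightarrow> v \<in> carrier M \<Longrightarrow>
    f (u \<oplus>\<^bsub>M\<^esub> v) = f u \<oplus>\<^bsub>N\<^esub> f v"
  and module_hom_smult: "f \<in> module_hom R M N \<Longrightarrow> a \<in> carrier R \<Longrightarrow> u \<in> carrier M \<Longrightarrow>
    f (a \<odot>\<^bsub>M\<^esub> u) = a \<odot>\<^bsub>N\<^esub> f u"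
  by (simp_all add: module_hom_iff)

lemma module_hom_abelian_group_hom:
  assumes "f \<in> module_hom R M N" "module R M" "module R N"
  shows "abelian_group_hom M N f"
proof (rule abelian_group_homI)
  show "abelian_group M" "abelian_group N"
    using assms module.axioms(2) by blast+
  then have "group (add_monoid M)" "group (add_monoid N)"
    by (auto intro: abelian_group.a_group)
  then show "group_hom (add_monoid M) (add_monoid N) f"
    using assms by (simp add: group_hom_def group_hom_axioms_def module_hom_def)
qed

lemma module_hom_zero:
  assumes "f \<in> module_hom R M N" "module R M" "module R N"
  shows "f \<zero>\<^bsub>M\<^esub> = \<zero>\<^bsub>N\<^esub>"
  using abelian_group_hom.hom_zero module_hom_abelian_group_hom assms by blast

lemma module_hom_neg:
  assumes "f \<in> module_hom R M N" "module R M" "module R N" "u \<in> carrier M"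
  shows "f (\<ominus>\<^bsub>M\<^esub> u) = \<ominus>\<^bsub>N\<^esub> f u"
  using abelian_group_hom.hom_a_inv module_hom_abelian_group_hom assms by fast

lemma module_hom_minus:
  assumes "f \<in> module_hom R M N" "module R M" "module R N" "u \<in> carrier M" "v \<in> carrier M"
  shows "f (u \<ominus>\<^bsub>M\<^esub> v) = f u \<ominus>\<^bsub>N\<^esub> f v"
proof -
  interpret M: module R M by fact
  show ?thesis
    using assms by (simp add: a_minus_def module_hom_add module_hom_neg)
qed

lemmas module_hom_rules = module_hom_closed module_hom_add module_hom_smult
  module_hom_zero module_hom_neg module_hom_minus

lemma module_hom_comp:
  assumes "f \<in> module_hom R A B" "g \<in> module_hom R B C"
  shows "(\<lambda>u. g (f u)) \<in> module_hom R A C"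
  using assms by (simp add: module_hom_iff)

lemma module_hom_id: "(\<lambda>u. u) \<in> module_hom R A A"
  by (simp add: module_hom_iff)

lemma module_hom_scale:
  assumes "module R A" "x \<in> carrier R"
  shows "(\<lambda>u. x \<odot>\<^bsub>A\<^esub> u) \<in> module_hom R A A"
proof -
  interpret A: module R A by fact
  show ?thesis using assms
    by (auto simp: module_hom_iff A.smult_r_distr A.smult_assoc1[symmetric] A.R.m_comm)
qed

lemma module_hom_add_fun:
  assumes "module R A" "module R B" "f \<in> module_hom R A B" "g \<in> module_hom R A B"
  shows "(\<lambda>u. f u \<oplus>\<^bsub>B\<^esub> g u) \<in> module_hom R A B"
proof -
  interpret A: module R A by fact
  interpret B: module R B by fact
  show ?thesis using assms(3,4)
    by (auto simp: module_hom_iff B.smult_r_distr B.a_ac)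
qed

lemma module_hom_minus_fun:
  assumes "module R A" "module R B" "f \<in> module_hom R A B" "g \<in> module_hom R A B"
  shows "(\<lambda>u. f u \<ominus>\<^bsub>B\<^esub> g u) \<in> module_hom R A B"
proof -
  interpret A: module R A by fact
  interpret B: module R B by fact
  show ?thesis using assms(3,4)
    by (auto simp: module_hom_iff B.smult_r_distr B.a_ac B.minus_add B.minus_eq B.smult_r_minus)
qed

section \<open>Kernels as modules\<close>

lemma mem_a_kernel: "u \<in> a_kernel M N f \<longleftrightarrow> u \<in> carrier M \<and> f u = \<zero>\<^bsub>N\<^esub>"
  by (simp add: a_kernel_def')

lemma a_kernel_submodule:
  assumes "module R M" "module R N" "f \<in> module_hom R M N"
  shows "submodule (a_kernel M N f) R M"
proof -
  interpret M: module R M by fact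
  interpret N: module R N by fact
  show ?thesis using assms
    by (intro M.submoduleI) (auto simp: mem_a_kernel module_hom_rules)
qed

text \<open>Only the carrier of \<open>M\<close> changes, so a kernel stays on the type of
  \<open>M\<close>, iterated syzygies stay in the universe, and the inclusion into \<open>M\<close>
  is the identity function.\<close>

abbreviation ker_module ::
    "('a, 'b) module \<Rightarrow> ('a, 'd) module \<Rightarrow> ('b \<Rightarrow> 'd) \<Rightarrow> ('a, 'b) module" where
  "ker_module M N f \<equiv> M\<lparr>carrier := a_kernel M N f\<rparr>"

lemma module_ker_module:
  assumes "module R M" "module R N" "f \<in> module_hom R M N"
  shows "module R (ker_module M N f)"
  using submodule.submodule_is_module[OF a_kernel_submodule[OF assms] assms(1)] .

lemma module_hom_to_ker_module:
  assumes "h \<in> module_hom R A M" "\<And>u. u \<in> carrier A \<Longrightarrow> f (h u) = \<zero>\<^bsub>N\<^esub>"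
  shows "h \<in> module_hom R A (ker_module M N f)"
  using assms by (auto simp: module_hom_iff mem_a_kernel)

lemma module_hom_from_ker_module:
  assumes "h \<in> module_hom R M A"
  shows "h \<in> module_hom R (ker_module M N f) A"
  using assms by (auto simp: module_hom_iff mem_a_kernel)

section \<open>Subtraction in abelian groups and injectivity of homomorphisms\<close>

lemma (in abelian_group) minus_eq_zero_iff:
  assumes "a \<in> carrier G" "b \<in> carrier G"
  shows "a \<ominus> b = \<zero> \<longleftrightarrow> a = b"
  using assms by (metis add.inv_comm add.inv_equality a_minus_def minus_minus r_neg a_inv_closed)

lemma (in abelian_group) minus_minus_minus:
  assumes "a \<in> carrier G" "b \<in> carrier G" "c \<in> carrier G"
  shows "(a \<ominus> c) \<ominus> (b \<ominus> c) = a \<ominus> b"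
proof -
  have "(a \<ominus> c) \<ominus> (b \<ominus> c) = (a \<oplus> \<ominus> b) \<oplus> (c \<oplus> \<ominus> c)"
    unfolding a_minus_def using assms by (simp add: minus_add a_assoc a_comm a_lcomm)
  then show ?thesis using assms by (simp add: r_neg a_minus_def)
qed

lemma (in abelian_group) minus_add_minus:
  assumes "a \<in> carrier G" "b \<in> carrier G" "c \<in> carrier G"
  shows "(a \<ominus> b) \<oplus> (b \<ominus> c) = a \<ominus> c"
  using assms by (simp add: a_minus_def a_assoc r_neg1)

lemma (in abelian_group) minus_add_cancel:
  assumes "a \<in> carrier G" "b \<in> carrier G"
  shows "(a \<ominus> b) \<oplus> b = a"
  using assms by (simp add: a_minus_def a_assoc l_neg)

lemma (in abelian_group) neg_minus:
  assumes "a \<in> carrier G" "b \<in> carrier G"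
  shows "\<ominus> (a \<ominus> b) = b \<ominus> a"
  using assms by (simp add: a_minus_def minus_add a_comm)

lemma (in abelian_group) add_minus_add:
  assumes "a \<in> carrier G" "b \<in> carrier G" "c \<in> carrier G" "d \<in> carrier G"
  shows "(a \<oplus> b) \<ominus> (c \<oplus> d) = (a \<ominus> c) \<oplus> (b \<ominus> d)"
  using assms by (simp add: a_minus_def minus_add a_ac)

lemma module_hom_inj_on:
  assumes "module R M" "module R N" "f \<in> module_hom R M N"
    and "\<And>u. u \<in> carrier M \<Longrightarrow> f u = \<zero>\<^bsub>N\<^esub> \<Longrightarrow> u = \<zero>\<^bsub>M\<^esub>"
  shows "inj_on f (carrier M)"
proof (rule inj_onI)
  interpret M: module R M by fact
  interpret N: module R N by fact
  fix u v assume *: "u \<in> carrier M" "v \<in> carrier M" "f u = f v"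
  then have "f (u \<ominus>\<^bsub>M\<^esub> v) = \<zero>\<^bsub>N\<^esub>"
    using assms by (simp add: module_hom_rules N.minus_eq_zero_iff)
  then show "u = v"
    using * assms(4)[of "u \<ominus>\<^bsub>M\<^esub> v"] by (simp add: M.minus_eq_zero_iff)
qed

section \<open>Factor modules and transport of structure\<close>

text \<open>The universal property of a quotient, for an arbitrary surjection \<open>\<pi>\<close>
  instead of cosets. The map \<open>g\<close> evaluates \<open>f\<close> at a chosen preimage; two
  preimages differ by an element of the kernel of \<open>\<pi>\<close>, where \<open>f\<close>
  vanishes.\<close>

lemma module_hom_factor:
  assumes "module R P" "module R B" "module R N"
    and "\<pi> \<in> module_hom R P B" "\<pi> ` carrier P = carrier B" "f \<in> module_hom R P N"
    and "\<And>p. p \<in> carrier P \<Longrightarrow> \<pi> p = \<zero>\<^bsub>B\<^esub> \<Longrightarrow> f p = \<zero>\<^bsub>N\<^esub>"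
  obtains g where "g \<in> module_hom R B N" "\<And>p. p \<in> carrier P \<Longrightarrow> g (\<pi> p) = f p"
proof -
  interpret P: module R P by fact
  interpret B: module R B by fact
  interpret N: module R N by fact
  define g where "g b = f (inv_into (carrier P) \<pi> b)" for b
  have g: "g (\<pi> p) = f p" if "p \<in> carrier P" for p
  proof -
    let ?q = "inv_into (carrier P) \<pi> (\<pi> p)"
    have q: "?q \<in> carrier P" "\<pi> ?q = \<pi> p"
      using that by (auto intro: inv_into_into f_inv_into_f)
    then have "\<pi> (?q \<ominus>\<^bsub>P\<^esub> p) = \<zero>\<^bsub>B\<^esub>"
      using that assms by (simp add: module_hom_rules B.minus_eq_zero_iff)
    then have "f (?q \<ominus>\<^bsub>P\<^esub> p) = \<zero>\<^bsub>N\<^esub>"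
      using q that assms(7) by simp
    then show ?thesis
      using q that assms by (simp add: g_def module_hom_rules N.minus_eq_zero_iff)
  qed
  have "g \<in> module_hom R B N"
  proof (rule module_homI)
    fix u assume "u \<in> carrier B"
    then obtain p where p: "p \<in> carrier P" "u = \<pi> p" using assms(5) by blast
    then show "g u \<in> carrier N" using g assms(6) by (simp add: module_hom_rules)
    { fix a assume a: "a \<in> carrier R"
      have "g (a \<odot>\<^bsub>B\<^esub> u) = g (\<pi> (a \<odot>\<^bsub>P\<^esub> p))"
        using p a assms by (simp add: module_hom_rules)
      also have "\<dots> = f (a \<odot>\<^bsub>P\<^esub> p)"
        using p a by (intro g) simp
      also have "\<dots> = a \<odot>\<^bsub>N\<^esub> g u"
        using p a assms g by (simp add: module_hom_rules)
      finally show "g (a \<odot>\<^bsub>B\<^esub> u) = a \<odot>\<^bsub>N\<^esub> g u" . }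
    { fix v assume "v \<in> carrier B"
      then obtain q where q: "q \<in> carrier P" "v = \<pi> q" using assms(5) by blast
      have "g (u \<oplus>\<^bsub>B\<^esub> v) = g (\<pi> (p \<oplus>\<^bsub>P\<^esub> q))"
        using p q assms by (simp add: module_hom_rules)
      also have "\<dots> = f (p \<oplus>\<^bsub>P\<^esub> q)"
        using p q by (intro g) simp
      also have "\<dots> = g u \<oplus>\<^bsub>N\<^esub> g v"
        using p q g assms(6) by (simp add: module_hom_rules)
      finally show "g (u \<oplus>\<^bsub>B\<^esub> v) = g u \<oplus>\<^bsub>N\<^esub> g v" . }
  qed
  with g show thesis using that by blast
qed

text \<open>The operations are computed on chosen preimages. With an injective \<open>\<pi>\<close>
  this is a copy of \<open>A\<close> on another type; with a \<open>\<pi>\<close> that picks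
  representatives it is a factor module.\<close>

definition module_image :: "('b \<Rightarrow> 'd) \<Rightarrow> ('a, 'b) module \<Rightarrow> ('a, 'd) module" where
  "module_image \<pi> A = \<lparr>carrier = \<pi> ` carrier A, monoid.mult = undefined, one = undefined,
     ring.zero = \<pi> \<zero>\<^bsub>A\<^esub>,
     ring.add = (\<lambda>u v. \<pi> (inv_into (carrier A) \<pi> u \<oplus>\<^bsub>A\<^esub> inv_into (carrier A) \<pi> v)),
     module.smult = (\<lambda>a u. \<pi> (a \<odot>\<^bsub>A\<^esub> inv_into (carrier A) \<pi> u))\<rparr>"

lemma module_image_simps:
  "carrier (module_image \<pi> A) = \<pi> ` carrier A" "\<zero>\<^bsub>module_image \<pi> A\<^esub> = \<pi> \<zero>\<^bsub>A\<^esub>"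
  by (simp_all add: module_image_def)

text \<open>The two congruence conditions make the operations independent of the chosen preimages,
  so the module laws are inherited from \<open>A\<close>.\<close>

lemma
  assumes "module R A"
    and add: "\<And>a a' b b'. \<lbrakk>a \<in> carrier A; a' \<in> carrier A; b \<in> carrier A; b' \<in> carrier A;
      \<pi> a = \<pi> a'; \<pi> b = \<pi> b'\<rbrakk> \<Longrightarrow> \<pi> (a \<oplus>\<^bsub>A\<^esub> b) = \<pi> (a' \<oplus>\<^bsub>A\<^esub> b')"
    and smult: "\<And>r a a'. \<lbrakk>r \<in> carrier R; a \<in> carrier A; a' \<in> carrier A; \<pi> a = \<pi> a'\<rbrakk> \<Longrightarrow>
      \<pi> (r \<odot>\<^bsub>A\<^esub> a) = \<pi> (r \<odot>\<^bsub>A\<^esub> a')"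
  shows module_module_image: "module R (module_image \<pi> A)"
    and module_image_hom: "\<pi> \<in> module_hom R A (module_image \<pi> A)"
proof -
  interpret A: module R A by fact
  let ?Q = "module_image \<pi> A"
  let ?i = "inv_into (carrier A) \<pi>"
  have i: "?i (\<pi> a) \<in> carrier A" "\<pi> (?i (\<pi> a)) = \<pi> a" if "a \<in> carrier A" for a
    using that by (auto intro: inv_into_into f_inv_into_f)
  have plus: "\<pi> a \<oplus>\<^bsub>?Q\<^esub> \<pi> b = \<pi> (a \<oplus>\<^bsub>A\<^esub> b)" if "a \<in> carrier A" "b \<in> carrier A" for a b
    using that i by (auto simp: module_image_def intro: add)
  have times: "r \<odot>\<^bsub>?Q\<^esub> \<pi> a = \<pi> (r \<odot>\<^bsub>A\<^esub> a)" if "r \<in> carrier R" "a \<in> carrier A" for r a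
    using that i by (auto simp: module_image_def intro: smult)
  have ag: "abelian_group ?Q"
  proof (rule abelian_groupI)
    fix u assume "u \<in> carrier ?Q"
    then obtain a where "a \<in> carrier A" "u = \<pi> a" by (auto simp: module_image_simps)
    then show "\<exists>v\<in>carrier ?Q. v \<oplus>\<^bsub>?Q\<^esub> u = \<zero>\<^bsub>?Q\<^esub>"
      by (intro bexI[of _ "\<pi> (\<ominus>\<^bsub>A\<^esub> a)"]) (auto simp: module_image_simps plus A.l_neg)
  qed (auto simp: module_image_simps plus A.a_ac)
  show "module R ?Q"
    using A.R.cring_axioms ag
    by (intro moduleI) (auto simp: module_image_simps plus times A.smult_l_distr A.smult_r_distr
        A.smult_assoc1)
  show "\<pi> \<in> module_hom R A ?Q"
    by (rule module_homI) (auto simp: module_image_simps plus times)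
qed

lemma module_transport:
  assumes "module R A" "inj_on \<pi> (carrier A)"
  shows "module R (module_image \<pi> A)" "\<pi> \<in> module_hom R A (module_image \<pi> A)"
    "inv_into (carrier A) \<pi> \<in> module_hom R (module_image \<pi> A) A"
proof -
  interpret A: module R A by fact
  show M: "module R (module_image \<pi> A)" and h: "\<pi> \<in> module_hom R A (module_image \<pi> A)"
    using assms by (auto intro!: module_module_image module_image_hom dest: inj_onD)
  obtain g where g: "g \<in> module_hom R (module_image \<pi> A) A"
      "\<And>p. p \<in> carrier A \<Longrightarrow> g (\<pi> p) = p"
  proof (rule module_hom_factor[OF assms(1) M assms(1) h _ module_hom_id])
    fix p assume "p \<in> carrier A" "\<pi> p = \<zero>\<^bsub>module_image \<pi> A\<^esub>"
    then show "p = \<zero>\<^bsub>A\<^esub>"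
      using assms(2) by (simp add: module_image_simps inj_on_eq_iff)
  qed (auto simp: module_image_simps)
  have "inv_into (carrier A) \<pi> u = g u" if "u \<in> carrier (module_image \<pi> A)" for u
    using that g(2) assms(2) by (auto simp: module_image_simps)
  moreover interpret Q: module R "module_image \<pi> A" by (rule M)
  show "inv_into (carrier A) \<pi> \<in> module_hom R (module_image \<pi> A) A"
    using g(1) calculation by (auto simp: module_hom_iff)
qed

text \<open>Cosets are sets of elements of \<open>'u\<close> and would leave the universe. Instead
  \<open>\<pi>\<close> sends each element to a representative of its coset, and the structure is
  transported to the set of representatives.\<close>

lemma quotient_module_exists:
  fixes A :: "('a, 'u) module"
  assumes "module R A" "submodule N R A"
  obtains Q :: "('a, 'u) module" and \<pi> where "module R Q" "\<pi> \<in> module_hom R A Q"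
    "\<pi> ` carrier A = carrier Q" "\<And>a. a \<in> carrier A \<Longrightarrow> \<pi> a = \<zero>\<^bsub>Q\<^esub> \<longleftrightarrow> a \<in> N"
proof -
  interpret A: module R A by fact
  note N = A.submoduleE[OF assms(2)]
  have N0: "\<zero>\<^bsub>A\<^esub> \<in> N"
    using subgroup.one_closed[OF submodule.axioms(1)[OF assms(2)]] by simp
  define \<pi> where "\<pi> a = (SOME q. q \<in> carrier A \<and> a \<ominus>\<^bsub>A\<^esub> q \<in> N)" for a
  have \<pi>: "\<pi> a \<in> carrier A" "a \<ominus>\<^bsub>A\<^esub> \<pi> a \<in> N" if "a \<in> carrier A" for a
  proof -
    have "a \<ominus>\<^bsub>A\<^esub> a \<in> N"
      using that N0 by (simp add: a_minus_def A.r_neg)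
    then have "\<exists>q. q \<in> carrier A \<and> a \<ominus>\<^bsub>A\<^esub> q \<in> N"
      using that by blast
    from someI_ex[OF this] have "\<pi> a \<in> carrier A \<and> a \<ominus>\<^bsub>A\<^esub> \<pi> a \<in> N"
      by (simp only: \<pi>_def)
    then show "\<pi> a \<in> carrier A" "a \<ominus>\<^bsub>A\<^esub> \<pi> a \<in> N" by auto
  qed
  have sub: "u \<ominus>\<^bsub>A\<^esub> v \<in> N" if "u \<in> N" "v \<in> N" for u v
    using that N by (simp add: a_minus_def)
  have iff: "\<pi> a = \<pi> b \<longleftrightarrow> a \<ominus>\<^bsub>A\<^esub> b \<in> N" if ab: "a \<in> carrier A" "b \<in> carrier A" for a b
  proof
    assume "\<pi> a = \<pi> b"
    then show "a \<ominus>\<^bsub>A\<^esub> b \<in> N"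
      using sub[OF \<pi>(2)[OF ab(1)] \<pi>(2)[OF ab(2)]] A.minus_minus_minus[OF ab \<pi>(1)[OF ab(2)]]
      by simp
  next
    assume *: "a \<ominus>\<^bsub>A\<^esub> b \<in> N"
    \<comment> \<open>Two elements of one coset give the same predicate, hence literally the same
      choice by \<open>SOME\<close>.\<close>
    have "a \<ominus>\<^bsub>A\<^esub> q \<in> N \<longleftrightarrow> b \<ominus>\<^bsub>A\<^esub> q \<in> N" if q: "q \<in> carrier A" for q
      using N(5)[OF *, of "b \<ominus>\<^bsub>A\<^esub> q"] N(3)[OF *] N(5)[of "b \<ominus>\<^bsub>A\<^esub> a" "a \<ominus>\<^bsub>A\<^esub> q"]
      by (metis A.minus_add_minus A.neg_minus ab q)
    then have "(\<lambda>q. q \<in> carrier A \<and> a \<ominus>\<^bsub>A\<^esub> q \<in> N) = (\<lambda>q. q \<in> carrier A \<and> b \<ominus>\<^bsub>A\<^esub> q \<in> N)"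
      by blast
    then show "\<pi> a = \<pi> b"
      unfolding \<pi>_def by (rule arg_cong)
  qed
  let ?Q = "module_image \<pi> A"
  have add: "\<pi> (a \<oplus>\<^bsub>A\<^esub> b) = \<pi> (a' \<oplus>\<^bsub>A\<^esub> b')"
    if ab: "a \<in> carrier A" "a' \<in> carrier A" "b \<in> carrier A" "b' \<in> carrier A"
      "\<pi> a = \<pi> a'" "\<pi> b = \<pi> b'" for a a' b b'
  proof -
    have "(a \<ominus>\<^bsub>A\<^esub> a') \<oplus>\<^bsub>A\<^esub> (b \<ominus>\<^bsub>A\<^esub> b') \<in> N" using ab N(5) by (simp add: iff)
    then show ?thesis using ab by (simp add: iff A.add_minus_add)
  qed
  have smult: "\<pi> (r \<odot>\<^bsub>A\<^esub> a) = \<pi> (r \<odot>\<^bsub>A\<^esub> a')"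
    if ab: "r \<in> carrier R" "a \<in> carrier A" "a' \<in> carrier A" "\<pi> a = \<pi> a'" for r a a'
  proof -
    have "r \<odot>\<^bsub>A\<^esub> (a \<ominus>\<^bsub>A\<^esub> a') \<in> N" using ab N(4) by (simp add: iff)
    then show ?thesis using ab
      by (simp add: iff) (simp add: a_minus_def A.smult_r_distr A.smult_r_minus)
  qed
  show thesis
  proof (rule that[of ?Q \<pi>])
    show "module R ?Q" by (rule module_module_image[OF assms(1) add smult])
    show "\<pi> \<in> module_hom R A ?Q" by (rule module_image_hom[OF assms(1) add smult])
    show "\<pi> ` carrier A = carrier ?Q" by (simp add: module_image_simps)
    show "\<pi> a = \<zero>\<^bsub>?Q\<^esub> \<longleftrightarrow> a \<in> N" if "a \<in> carrier A" for a
      using that A.minus_add_cancel[of a "\<zero>\<^bsub>A\<^esub>"] by (simp add: module_image_simps iff)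
  qed
qed

section \<open>Binary direct sums\<close>

definition dsum :: "('a, 'b) module \<Rightarrow> ('a, 'd) module \<Rightarrow> ('a, 'b \<times> 'd) module" where
  "dsum A B = \<lparr>carrier = carrier A \<times> carrier B, monoid.mult = undefined, one = undefined,
     ring.zero = (\<zero>\<^bsub>A\<^esub>, \<zero>\<^bsub>B\<^esub>),
     ring.add = (\<lambda>u v. (fst u \<oplus>\<^bsub>A\<^esub> fst v, snd u \<oplus>\<^bsub>B\<^esub> snd v)),
     module.smult = (\<lambda>a u. (a \<odot>\<^bsub>A\<^esub> fst u, a \<odot>\<^bsub>B\<^esub> snd u))\<rparr>"

lemma dsum_simps [simp]:
  "carrier (dsum A B) = carrier A \<times> carrier B" "\<zero>\<^bsub>dsum A B\<^esub> = (\<zero>\<^bsub>A\<^esub>, \<zero>\<^bsub>B\<^esub>)"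
  "u \<oplus>\<^bsub>dsum A B\<^esub> v = (fst u \<oplus>\<^bsub>A\<^esub> fst v, snd u \<oplus>\<^bsub>B\<^esub> snd v)"
  "a \<odot>\<^bsub>dsum A B\<^esub> u = (a \<odot>\<^bsub>A\<^esub> fst u, a \<odot>\<^bsub>B\<^esub> snd u)"
  by (simp_all add: dsum_def)

lemma module_dsum:
  assumes "module R A" "module R B"
  shows "module R (dsum A B)"
proof -
  interpret A: module R A by fact
  interpret B: module R B by fact
  have ag: "abelian_group (dsum A B)"
  proof (rule abelian_groupI)
    fix u assume "u \<in> carrier (dsum A B)"
    then show "\<exists>v\<in>carrier (dsum A B). v \<oplus>\<^bsub>dsum A B\<^esub> u = \<zero>\<^bsub>dsum A B\<^esub>"
      by (intro bexI[of _ "(\<ominus>\<^bsub>A\<^esub> fst u, \<ominus>\<^bsub>B\<^esub> snd u)"]) (auto simp: A.l_neg B.l_neg)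
  qed (auto simp: A.a_ac B.a_ac)
  then show ?thesis
    using A.R.cring_axioms
    by (intro moduleI) (auto simp: A.smult_l_distr A.smult_r_distr A.smult_assoc1
        B.smult_l_distr B.smult_r_distr B.smult_assoc1)
qed

lemma dsum_fst_hom: "fst \<in> module_hom R (dsum A B) A"
  and dsum_snd_hom: "snd \<in> module_hom R (dsum A B) B"
  by (auto simp: module_hom_iff)

lemma dsum_copair_hom:
  assumes "module R C" "f \<in> module_hom R A C" "g \<in> module_hom R B C"
  shows "(\<lambda>u. f (fst u) \<oplus>\<^bsub>C\<^esub> g (snd u)) \<in> module_hom R (dsum A B) C"
proof -
  interpret C: module R C by fact
  show ?thesis using assms
    by (auto simp: module_hom_iff C.smult_r_distr C.a_ac)
qed

lemma dsum_inl_hom: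
  assumes "module R A" "module R B"
  shows "(\<lambda>a. (a, \<zero>\<^bsub>B\<^esub>)) \<in> module_hom R A (dsum A B)"
proof -
  interpret B: module R B by fact
  show ?thesis by (auto simp: module_hom_iff)
qed

lemma dsum_inr_hom:
  assumes "module R A" "module R B"
  shows "(\<lambda>b. (\<zero>\<^bsub>A\<^esub>, b)) \<in> module_hom R B (dsum A B)"
proof -
  interpret A: module R A by fact
  show ?thesis by (auto simp: module_hom_iff)
qed

section \<open>Projective modules and projective dimension\<close>

lemma module_hom_zero_fun:
  assumes "module R A" "module R B"
  shows "(\<lambda>u. \<zero>\<^bsub>B\<^esub>) \<in> module_hom R A B"
proof -
  interpret B: module R B by fact
  show ?thesis by (auto simp: module_hom_iff)
qed

lemma module_hom_inverse:
  assumes "module R A" "module R B" "h \<in> module_hom R A B" "h ` carrier A = carrier B"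
    and "\<And>a. a \<in> carrier A \<Longrightarrow> h a = \<zero>\<^bsub>B\<^esub> \<Longrightarrow> a = \<zero>\<^bsub>A\<^esub>"
  obtains k where "k \<in> module_hom R B A" "\<And>a. a \<in> carrier A \<Longrightarrow> k (h a) = a"
    "\<And>b. b \<in> carrier B \<Longrightarrow> h (k b) = b"
proof -
  obtain k where k: "k \<in> module_hom R B A" "\<And>a. a \<in> carrier A \<Longrightarrow> k (h a) = a"
    using module_hom_factor[OF assms(1,2,1,3,4) module_hom_id] assms(5) by blast
  moreover have "h (k b) = b" if "b \<in> carrier B" for b
  proof -
    from that obtain a where "a \<in> carrier A" "b = h a" using assms(4) by blast
    then show ?thesis using k(2) by simp
  qed
  ultimately show thesis using that by blast
qed

lemma projective_moduleD: "projective_module R P \<Longrightarrow> module R P"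
  by (simp add: projective_module_def)

lemma projective_lift:
  fixes P A B :: "('a, 'u) module"
  assumes "projective_module R P" "module R A" "module R B"
    "g \<in> module_hom R A B" "g ` carrier A = carrier B" "f \<in> module_hom R P B"
  obtains h where "h \<in> module_hom R P A" "\<And>p. p \<in> carrier P \<Longrightarrow> g (h p) = f p"
  using assms unfolding projective_module_def by blast

lemma projective_section:
  fixes P A :: "('a, 'u) module"
  assumes "projective_module R P" "module R A" "g \<in> module_hom R A P" "g ` carrier A = carrier P"
  obtains s where "s \<in> module_hom R P A" "\<And>p. p \<in> carrier P \<Longrightarrow> g (s p) = p"
  using projective_lift[OF assms(1,2) projective_moduleD[OF assms(1)] assms(3,4) module_hom_id]
  by blast

text \<open>The equation \<open>sum\<close> says that \<open>A\<close> is a retract of the direct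
  sum of \<open>B\<close> and \<open>C\<close>, without forming that sum: \<open>f\<close> is lifted
  separately along \<open>i\<close> and \<open>j\<close>, and the lifts are recombined through
  \<open>q\<close> and \<open>p\<close>.\<close>

lemma projective_decomposition:
  fixes A B C :: "('a, 'u) module"
  assumes "module R A" "projective_module R B" "projective_module R C"
    and "i \<in> module_hom R B A" "j \<in> module_hom R C A" "q \<in> module_hom R A B" "p \<in> module_hom R A C"
    and sum: "\<And>a. a \<in> carrier A \<Longrightarrow> i (q a) \<oplus>\<^bsub>A\<^esub> j (p a) = a"
  shows "projective_module R A"
  unfolding projective_module_def
proof (intro conjI allI impI)
  show "module R A" by fact
next
  fix U V :: "('a, 'u) module" and g f
  assume U: "module R U" and V: "module R V" and g: "g \<in> module_hom R U V"
    and surj: "g ` carrier U = carrier V" and f: "f \<in> module_hom R A V"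
  obtain h1 where h1: "h1 \<in> module_hom R B U" "\<And>b. b \<in> carrier B \<Longrightarrow> g (h1 b) = f (i b)"
    using projective_lift[OF assms(2) U V g surj module_hom_comp[OF assms(4) f]] by blast
  obtain h2 where h2: "h2 \<in> module_hom R C U" "\<And>c. c \<in> carrier C \<Longrightarrow> g (h2 c) = f (j c)"
    using projective_lift[OF assms(3) U V g surj module_hom_comp[OF assms(5) f]] by blast
  show "\<exists>h\<in>module_hom R A U. \<forall>a\<in>carrier A. g (h a) = f a"
  proof (intro bexI ballI)
    show "(\<lambda>a. h1 (q a) \<oplus>\<^bsub>U\<^esub> h2 (p a)) \<in> module_hom R A U"
      by (intro module_hom_add_fun module_hom_comp[OF assms(6) h1(1)]
          module_hom_comp[OF assms(7) h2(1)] U assms(1))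
    fix a assume a: "a \<in> carrier A"
    then have mem: "q a \<in> carrier B" "p a \<in> carrier C"
      using assms(6,7) by (simp_all add: module_hom_closed)
    then have "g (h1 (q a) \<oplus>\<^bsub>U\<^esub> h2 (p a)) = f (i (q a)) \<oplus>\<^bsub>V\<^esub> f (j (p a))"
      using g h1 h2 by (simp add: module_hom_rules)
    also have "\<dots> = f (i (q a) \<oplus>\<^bsub>A\<^esub> j (p a))"
      using f assms(4,5) mem by (simp add: module_hom_rules)
    finally show "g (h1 (q a) \<oplus>\<^bsub>U\<^esub> h2 (p a)) = f a"
      using a by (simp add: sum)
  qed
qed

lemma projective_retract:
  fixes A B :: "('a, 'u) module"
  assumes "module R A" "projective_module R B" "i \<in> module_hom R B A" "q \<in> module_hom R A B"
    and "\<And>a. a \<in> carrier A \<Longrightarrow> i (q a) = a"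
  shows "projective_module R A"
proof -
  interpret A: module R A by fact
  show ?thesis
    \<comment> \<open>The second summand is another copy of \<open>B\<close>, mapped to
      \<open>A\<close> by zero.\<close>
    by (rule projective_decomposition[OF assms(1,2,2,3)
          module_hom_zero_fun[OF projective_moduleD[OF assms(2)] assms(1)] assms(4,4)])
      (simp add: assms(5))
qed

text \<open>An infinite type admits an injection of its square into itself; along it the direct sum
  on the product type is copied back into the universe. The equations for \<open>i\<close>,
  \<open>j\<close>, \<open>p\<close>, \<open>q\<close> are all that is used of the sum
  afterwards.\<close>

lemma dsum_exists:
  fixes A B :: "('a, 'u) module"
  assumes "infinite (UNIV :: 'u set)" "module R A" "module R B"
  obtains D :: "('a, 'u) module" and i j p q where "module R D"
    "i \<in> module_hom R A D" "j \<in> module_hom R B D" "p \<in> module_hom R D A" "q \<in> module_hom R D B"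
    "\<And>a. a \<in> carrier A \<Longrightarrow> p (i a) = a" "\<And>a. a \<in> carrier A \<Longrightarrow> q (i a) = \<zero>\<^bsub>B\<^esub>"
    "\<And>b. b \<in> carrier B \<Longrightarrow> p (j b) = \<zero>\<^bsub>A\<^esub>" "\<And>b. b \<in> carrier B \<Longrightarrow> q (j b) = b"
    "\<And>d. d \<in> carrier D \<Longrightarrow> i (p d) \<oplus>\<^bsub>D\<^esub> j (q d) = d"
proof -
  interpret A: module R A by fact
  interpret B: module R B by fact
  obtain \<pi> :: "'u \<times> 'u \<Rightarrow> 'u" where "inj \<pi>"
    using card_of_Times_same_infinite[OF assms(1)] by (auto simp: card_of_ordIso[symmetric] bij_betw_def)
  then have inj: "inj_on \<pi> (carrier (dsum A B))"
    by (rule inj_on_subset) simp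
  let ?S = "dsum A B"
  let ?D = "module_image \<pi> ?S"
  let ?k = "inv_into (carrier ?S) \<pi>"
  note t = module_transport[OF module_dsum[OF assms(2,3)] inj]
  have k: "inv_into (carrier A \<times> carrier B) \<pi> (\<pi> u) = u" if "u \<in> carrier A \<times> carrier B" for u
    using that inj by simp
  show thesis
  proof (rule that)
    show "module R ?D" by (rule t)
    show "(\<lambda>a. \<pi> (a, \<zero>\<^bsub>B\<^esub>)) \<in> module_hom R A ?D"
      by (rule module_hom_comp[OF dsum_inl_hom[OF assms(2,3)] t(2)])
    show "(\<lambda>b. \<pi> (\<zero>\<^bsub>A\<^esub>, b)) \<in> module_hom R B ?D"
      by (rule module_hom_comp[OF dsum_inr_hom[OF assms(2,3)] t(2)])
    show "(\<lambda>d. fst (?k d)) \<in> module_hom R ?D A"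
      by (rule module_hom_comp[OF t(3) dsum_fst_hom])
    show "(\<lambda>d. snd (?k d)) \<in> module_hom R ?D B"
      by (rule module_hom_comp[OF t(3) dsum_snd_hom])
    show "fst (?k (\<pi> (a, \<zero>\<^bsub>B\<^esub>))) = a" "snd (?k (\<pi> (a, \<zero>\<^bsub>B\<^esub>))) = \<zero>\<^bsub>B\<^esub>" if "a \<in> carrier A" for a
      using that by (simp_all add: k)
    show "fst (?k (\<pi> (\<zero>\<^bsub>A\<^esub>, b))) = \<zero>\<^bsub>A\<^esub>" "snd (?k (\<pi> (\<zero>\<^bsub>A\<^esub>, b))) = b" if "b \<in> carrier B" for b
      using that by (simp_all add: k)
    fix d assume "d \<in> carrier ?D"
    then obtain a b where ab: "a \<in> carrier A" "b \<in> carrier B" "d = \<pi> (a, b)"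
      by (auto simp: module_image_simps)
    have "\<pi> (a, \<zero>\<^bsub>B\<^esub>) \<oplus>\<^bsub>?D\<^esub> \<pi> (\<zero>\<^bsub>A\<^esub>, b) = \<pi> ((a, \<zero>\<^bsub>B\<^esub>) \<oplus>\<^bsub>?S\<^esub> (\<zero>\<^bsub>A\<^esub>, b))"
      using ab by (intro module_hom_add[OF t(2), symmetric]) simp_all
    then show "\<pi> (fst (?k d), \<zero>\<^bsub>B\<^esub>) \<oplus>\<^bsub>?D\<^esub> \<pi> (\<zero>\<^bsub>A\<^esub>, snd (?k d)) = d"
      using ab by (simp add: k)
  qed
qed

section \<open>Projective dimension through iterated syzygies\<close>

text \<open>By Schanuel's lemma below, the choice of the cover \<open>P\<close> does not matter.\<close>

primrec pd_le :: "('a, 'c) ring_scheme \<Rightarrow> nat \<Rightarrow> ('a, 'u) module \<Rightarrow> bool" where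
  "pd_le R 0 A \<longleftrightarrow> projective_module R A"
| "pd_le R (Suc n) A \<longleftrightarrow> module R A \<and> (\<exists>P f. projective_module R P \<and> f \<in> module_hom R P A \<and>
     f ` carrier P = carrier A \<and> pd_le R n (ker_module P A f))"

lemma pd_le_module: "pd_le R n A \<Longrightarrow> module R A"
  by (cases n) (auto dest: projective_moduleD)

lemma pd_le_SucI:
  fixes A P :: "('a, 'u) module"
  assumes "module R A" "projective_module R P" "f \<in> module_hom R P A"
    "f ` carrier P = carrier A" "pd_le R n (ker_module P A f)"
  shows "pd_le R (Suc n) A"
  using assms by auto

text \<open>Composing a cover of \<open>A\<close> with the isomorphism gives a cover of
  \<open>B\<close> with the same kernel.\<close>

lemma pd_le_iso:
  fixes A B :: "('a, 'u) module"
  assumes "pd_le R n A" "module R B" "h \<in> module_hom R A B" "h ` carrier A = carrier B"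
    and "\<And>a. a \<in> carrier A \<Longrightarrow> h a = \<zero>\<^bsub>B\<^esub> \<Longrightarrow> a = \<zero>\<^bsub>A\<^esub>"
  shows "pd_le R n B"
proof (cases n)
  case 0
  then have A: "projective_module R A" using assms(1) by simp
  obtain k where k: "k \<in> module_hom R B A" "\<And>b. b \<in> carrier B \<Longrightarrow> h (k b) = b"
    using module_hom_inverse[OF projective_moduleD[OF A] assms(2-4)] assms(5) by metis
  have "projective_module R B"
    by (rule projective_retract[OF assms(2) A assms(3) k])
  then show ?thesis
    using 0 by simp
next
  case (Suc n')
  then obtain P :: "('a, 'u) module" and f where P: "projective_module R P" "f \<in> module_hom R P A"
     "f ` carrier P = carrier A" "pd_le R n' (ker_module P A f)"
    using assms(1)[unfolded Suc pd_le.simps] by blast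
  have "a_kernel P B (\<lambda>p. h (f p)) = a_kernel P A f"
    using assms P module_hom_zero[OF assms(3) pd_le_module[OF assms(1)] assms(2)]
    by (auto simp: mem_a_kernel module_hom_closed)
  moreover have "(\<lambda>p. h (f p)) ` carrier P = carrier B"
    using P(3) assms(4) by (metis image_image)
  ultimately have "pd_le R (Suc n') B"
    using P assms(2) module_hom_comp[OF P(2) assms(3)]
    by (intro pd_le_SucI[where P = P and f = "\<lambda>p. h (f p)"]) simp_all
  then show ?thesis
    using Suc by simp
qed

text \<open>A section \<open>s\<close> of \<open>q\<close> exists, and subtracting
  \<open>s (q y)\<close> from \<open>y\<close> retracts \<open>Y\<close> onto the kernel.\<close>

lemma projective_kernel:
  fixes Y P :: "('a, 'u) module"
  assumes "projective_module R Y" "projective_module R P"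
    and "q \<in> module_hom R Y P" "q ` carrier Y = carrier P"
  shows "projective_module R (ker_module Y P q)"
proof -
  note Y = projective_moduleD[OF assms(1)] and P = projective_moduleD[OF assms(2)]
  interpret Y: module R Y by (rule Y)
  interpret P: module R P by (rule P)
  obtain s where s: "s \<in> module_hom R P Y" "\<And>p. p \<in> carrier P \<Longrightarrow> q (s p) = p"
    using projective_section[OF assms(2) Y assms(3,4)] by blast
  let ?r = "\<lambda>y. y \<ominus>\<^bsub>Y\<^esub> s (q y)"
  have "?r \<in> module_hom R Y (ker_module Y P q)"
    using module_hom_minus_fun[OF Y Y module_hom_id module_hom_comp[OF assms(3) s(1)]] s Y P assms(3)
    by (intro module_hom_to_ker_module) (simp_all add: module_hom_rules P.minus_eq_zero_iff)
  moreover have "?r y = y" if "y \<in> carrier (ker_module Y P q)" for y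
    using that module_hom_zero[OF s(1) P Y] Y.minus_add_cancel[of y "\<zero>\<^bsub>Y\<^esub>"]
    by (simp add: mem_a_kernel)
  ultimately show ?thesis
    using projective_retract[OF module_ker_module[OF Y P assms(3)] assms(1) _
        module_hom_from_ker_module[OF module_hom_id]] by blast
qed

text \<open>A cover \<open>F\<close> of \<open>Y\<close> restricts to a cover of the kernel of
  \<open>q\<close> by the kernel of the composite from \<open>F\<close> to \<open>P\<close>. That
  kernel is projective by \<open>projective_kernel\<close>, and the syzygy is the same as for
  \<open>Y\<close>.\<close>

lemma pd_le_kernel:
  fixes Y P :: "('a, 'u) module"
  assumes "pd_le R n Y" "projective_module R P"
    and "q \<in> module_hom R Y P" "q ` carrier Y = carrier P"
  shows "pd_le R n (ker_module Y P q)"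
proof (cases n)
  case 0
  then show ?thesis using assms projective_kernel by auto
next
  case (Suc n')
  note Y = pd_le_module[OF assms(1)] and P = projective_moduleD[OF assms(2)]
  obtain F :: "('a, 'u) module" and f where F: "projective_module R F" "f \<in> module_hom R F Y"
     "f ` carrier F = carrier Y" "pd_le R n' (ker_module F Y f)"
    using assms(1)[unfolded Suc pd_le.simps] by blast
  let ?g = "\<lambda>u. q (f u)"
  have g: "?g \<in> module_hom R F P" "?g ` carrier F = carrier P"
    using module_hom_comp[OF F(2) assms(3)] F(3) assms(4) by (auto simp flip: image_image)
  have "f ` carrier (ker_module F P ?g) = carrier (ker_module Y P q)"
    using F(3) by (force simp: mem_a_kernel image_iff)
  moreover have "f \<in> module_hom R (ker_module F P ?g) (ker_module Y P q)"
    by (intro module_hom_to_ker_module module_hom_from_ker_module F) (simp add: mem_a_kernel)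
  moreover have "a_kernel (ker_module F P ?g) (ker_module Y P q) f = a_kernel F Y f"
    using module_hom_zero[OF assms(3) Y P] by (auto simp: mem_a_kernel)
  ultimately have "pd_le R (Suc n') (ker_module Y P q)"
    using projective_kernel[OF F(1) assms(2) g] F(4) module_ker_module[OF Y P assms(3)]
    by (intro pd_le_SucI[where P = "ker_module F P ?g" and f = f]) simp_all
  then show ?thesis
    using Suc by simp
qed

text \<open>The horseshoe construction with a projective right end: if \<open>P\<close> covers the
  kernel of \<open>q\<close>, then the direct sum of \<open>P\<close> and \<open>L\<close> covers
  \<open>E\<close>, and the syzygy of \<open>E\<close> is a copy of the syzygy of that
  kernel.\<close>

lemma pd_le_extension:
  fixes E L :: "('a, 'u) module"
  assumes "infinite (UNIV :: 'u set)" "module R E" "projective_module R L"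
    and "q \<in> module_hom R E L" "q ` carrier E = carrier L" "pd_le R n (ker_module E L q)"
  shows "pd_le R n E"
proof -
  note E = assms(2) and L = projective_moduleD[OF assms(3)]
  note K = module_ker_module[OF E L assms(4)]
  interpret E: module R E by (rule E)
  interpret L: module R L by (rule L)
  obtain s where s: "s \<in> module_hom R L E" "\<And>l. l \<in> carrier L \<Longrightarrow> q (s l) = l"
    using projective_section[OF assms(3) E assms(4,5)] by blast
  have r: "(\<lambda>e. e \<ominus>\<^bsub>E\<^esub> s (q e)) \<in> module_hom R E (ker_module E L q)"
    using module_hom_minus_fun[OF E E module_hom_id module_hom_comp[OF assms(4) s(1)]] s E L assms(4)
    by (intro module_hom_to_ker_module) (simp_all add: module_hom_rules L.minus_eq_zero_iff)
  have sum: "e \<ominus>\<^bsub>E\<^esub> s (q e) \<oplus>\<^bsub>E\<^esub> s (q e) = e" if "e \<in> carrier E" for e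
    using that assms(4) s(1) by (simp add: module_hom_closed E.minus_add_cancel)
  show ?thesis
  proof (cases n)
    case 0
    then show ?thesis
      using projective_decomposition[OF E _ assms(3) module_hom_from_ker_module[OF module_hom_id]
          s(1) r assms(4)] assms(6) sum by simp
  next
    case (Suc n')
    obtain P :: "('a, 'u) module" and f where P: "projective_module R P" "f \<in> module_hom R P (ker_module E L q)"
      "f ` carrier P = carrier (ker_module E L q)" "pd_le R n' (ker_module P (ker_module E L q) f)"
      using assms(6)[unfolded Suc pd_le.simps] by blast
    note PM = projective_moduleD[OF P(1)]
    have fE: "f \<in> module_hom R P E"
      using P(2) by (auto simp: module_hom_iff mem_a_kernel)
    have qf: "q (f u) = \<zero>\<^bsub>L\<^esub>" if "u \<in> carrier P" for u
      using module_hom_closed[OF P(2) that] by (simp add: mem_a_kernel)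
    obtain D :: "('a, 'u) module" and i j pa pb where D: "module R D"
      "i \<in> module_hom R P D" "j \<in> module_hom R L D" "pa \<in> module_hom R D P" "pb \<in> module_hom R D L"
      "\<And>a. a \<in> carrier P \<Longrightarrow> pa (i a) = a" "\<And>a. a \<in> carrier P \<Longrightarrow> pb (i a) = \<zero>\<^bsub>L\<^esub>"
      "\<And>b. b \<in> carrier L \<Longrightarrow> pa (j b) = \<zero>\<^bsub>P\<^esub>" "\<And>b. b \<in> carrier L \<Longrightarrow> pb (j b) = b"
      "\<And>d. d \<in> carrier D \<Longrightarrow> i (pa d) \<oplus>\<^bsub>D\<^esub> j (pb d) = d"
      by (rule dsum_exists[OF assms(1) PM L]) (rule that)
    interpret D: module R D by (rule D)
    interpret P: module R P by (rule PM)
    have D_proj: "projective_module R D"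
      using projective_decomposition[OF D(1) P(1) assms(3) D(2,3,4,5,10)] .
    let ?F = "\<lambda>d. f (pa d) \<oplus>\<^bsub>E\<^esub> s (pb d)"
    have F: "?F \<in> module_hom R D E"
      by (rule module_hom_add_fun[OF D(1) E module_hom_comp[OF D(4) fE] module_hom_comp[OF D(5) s(1)]])
    have qF: "q (?F d) = pb d" if "d \<in> carrier D" for d
      using that D(4,5) fE s qf assms(4) by (simp add: module_hom_rules)
    have surj: "?F ` carrier D = carrier E"
    proof (intro equalityI subsetI)
      fix e assume e: "e \<in> carrier E"
      then have "e \<ominus>\<^bsub>E\<^esub> s (q e) \<in> a_kernel E L q"
        using module_hom_closed[OF r] by simp
      then obtain u where u: "u \<in> carrier P" "f u = e \<ominus>\<^bsub>E\<^esub> s (q e)"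
        using P(3) by (auto simp: image_iff) (metis imageE)
      have qe: "q e \<in> carrier L" using e assms(4) by (simp add: module_hom_closed)
      let ?d = "i u \<oplus>\<^bsub>D\<^esub> j (q e)"
      have "?d \<in> carrier D" "pa ?d = u" "pb ?d = q e"
        using u qe D by (simp_all add: module_hom_rules)
      then show "e \<in> ?F ` carrier D"
        using u sum[OF e] by (intro image_eqI[of _ _ ?d]) simp_all
    qed (use module_hom_closed[OF F] in auto)
    \<comment> \<open>Applying \<open>q\<close> to \<open>?F d\<close> returns the component
      \<open>pb d\<close>, so the kernel of \<open>?F\<close> lies in the summand \<open>P\<close>
      and is the image under \<open>i\<close> of the kernel of \<open>f\<close>.\<close>
    have "pd_le R n' (ker_module D E ?F)"
    proof (rule pd_le_iso[OF P(4)])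
      show "module R (ker_module D E ?F)" by (rule module_ker_module[OF D(1) E F])
      show "i \<in> module_hom R (ker_module P (ker_module E L q) f) (ker_module D E ?F)"
        using D(6,7) fE module_hom_zero[OF s(1) L E]
        by (intro module_hom_to_ker_module module_hom_from_ker_module D) (simp add: mem_a_kernel)
      from module_hom_closed[OF this]
      have sub: "i ` carrier (ker_module P (ker_module E L q) f) \<subseteq> carrier (ker_module D E ?F)"
        by blast
      show "i ` carrier (ker_module P (ker_module E L q) f) = carrier (ker_module D E ?F)"
      proof (intro equalityI sub subsetI)
        fix d assume "d \<in> carrier (ker_module D E ?F)"
        then have d: "d \<in> carrier D" "?F d = \<zero>\<^bsub>E\<^esub>" by (auto simp: mem_a_kernel)
        then have "pb d = \<zero>\<^bsub>L\<^esub>"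
          using qF[OF d(1)] module_hom_zero[OF assms(4) E L] by simp
        moreover have pa: "pa d \<in> carrier P" using d D(4) by (simp add: module_hom_closed)
        ultimately have "f (pa d) = \<zero>\<^bsub>E\<^esub>" "d = i (pa d)"
          using d D(10)[OF d(1)] module_hom_zero[OF s(1) L E] module_hom_zero[OF D(3) L D(1)]
            module_hom_closed[OF fE] module_hom_closed[OF D(2)]
          by auto
        then show "d \<in> i ` carrier (ker_module P (ker_module E L q) f)"
          using pa by (auto simp: mem_a_kernel)
      qed
      fix a assume "a \<in> carrier (ker_module P (ker_module E L q) f)" "i a = \<zero>\<^bsub>ker_module D E ?F\<^esub>"
      then have "a \<in> carrier P" "i a = \<zero>\<^bsub>D\<^esub>" by (auto simp: mem_a_kernel)
      then show "a = \<zero>\<^bsub>ker_module P (ker_module E L q) f\<^esub>"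
        using D(6)[of a] module_hom_zero[OF D(4) D(1) PM] by simp
    qed
    then show ?thesis
      using Suc D_proj F surj E by auto
  qed
qed

text \<open>The fibre product \<open>Y\<close> of \<open>P\<close> and \<open>P'\<close> over
  \<open>A\<close> maps onto \<open>P'\<close> with kernel isomorphic to that of \<open>f\<close>,
  and onto \<open>P\<close> with kernel isomorphic to that of \<open>f'\<close>. The bound climbs
  from the kernel of \<open>f\<close> to \<open>Y\<close> by \<open>pd_le_extension\<close> and
  descends to the kernel of \<open>f'\<close> by \<open>pd_le_kernel\<close>.\<close>

lemma schanuel:
  fixes P P' A :: "('a, 'u) module"
  assumes "infinite (UNIV :: 'u set)" "module R A" "projective_module R P" "projective_module R P'"
    and "f \<in> module_hom R P A" "f ` carrier P = carrier A"
    and "f' \<in> module_hom R P' A" "f' ` carrier P' = carrier A"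
    and "pd_le R n (ker_module P A f)"
  shows "pd_le R n (ker_module P' A f')"
proof -
  note A = assms(2) and P = projective_moduleD[OF assms(3)] and P' = projective_moduleD[OF assms(4)]
  obtain D :: "('a, 'u) module" and i j pa pb where D: "module R D"
    "i \<in> module_hom R P D" "j \<in> module_hom R P' D" "pa \<in> module_hom R D P" "pb \<in> module_hom R D P'"
    "\<And>a. a \<in> carrier P \<Longrightarrow> pa (i a) = a" "\<And>a. a \<in> carrier P \<Longrightarrow> pb (i a) = \<zero>\<^bsub>P'\<^esub>"
    "\<And>b. b \<in> carrier P' \<Longrightarrow> pa (j b) = \<zero>\<^bsub>P\<^esub>" "\<And>b. b \<in> carrier P' \<Longrightarrow> pb (j b) = b"
    "\<And>d. d \<in> carrier D \<Longrightarrow> i (pa d) \<oplus>\<^bsub>D\<^esub> j (pb d) = d"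
    by (rule dsum_exists[OF assms(1) P P']) (rule that)
  interpret A: module R A by (rule A)
  interpret P: module R P by (rule P)
  interpret P': module R P' by (rule P')
  interpret D: module R D by (rule D)
  let ?c = "\<lambda>d. f (pa d) \<ominus>\<^bsub>A\<^esub> f' (pb d)"
  have c: "?c \<in> module_hom R D A"
    by (rule module_hom_minus_fun[OF D(1) A module_hom_comp[OF D(4) assms(5)]
          module_hom_comp[OF D(5) assms(7)]])
  \<comment> \<open>The fibre product, realised inside the direct sum \<open>D\<close> as the kernel
    of the difference of the two maps to \<open>A\<close>.\<close>
  define Y where "Y = ker_module D A ?c"
  have Y: "module R Y"
    unfolding Y_def by (rule module_ker_module[OF D(1) A c])
  have memY: "d \<in> carrier Y \<longleftrightarrow> d \<in> carrier D \<and> f (pa d) = f' (pb d)" for d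
    using assms(5,7) D(4,5) by (auto simp: Y_def mem_a_kernel module_hom_closed A.minus_eq_zero_iff)
  have [simp]: "\<zero>\<^bsub>Y\<^esub> = \<zero>\<^bsub>D\<^esub>" by (simp add: Y_def)
  have pairs: "i u \<oplus>\<^bsub>D\<^esub> j v \<in> carrier Y" "pa (i u \<oplus>\<^bsub>D\<^esub> j v) = u" "pb (i u \<oplus>\<^bsub>D\<^esub> j v) = v"
    if "u \<in> carrier P" "v \<in> carrier P'" "f u = f' v" for u v
    using that D by (simp_all add: memY module_hom_rules)
  have pa: "pa \<in> module_hom R Y P" and pb: "pb \<in> module_hom R Y P'"
    unfolding Y_def using D(4,5) by (intro module_hom_from_ker_module; simp)+
  have pa_surj: "pa ` carrier Y = carrier P"
  proof (intro equalityI subsetI)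
    fix u assume u: "u \<in> carrier P"
    then have "f u \<in> f' ` carrier P'" using assms(5,8) by (simp add: module_hom_closed)
    then show "u \<in> pa ` carrier Y" using pairs[OF u] by (metis imageE image_eqI)
  qed (use pa in \<open>auto simp: module_hom_closed\<close>)
  have pb_surj: "pb ` carrier Y = carrier P'"
  proof (intro equalityI subsetI)
    fix v assume v: "v \<in> carrier P'"
    then have "f' v \<in> f ` carrier P" using assms(6,7) by (simp add: module_hom_closed)
    then show "v \<in> pb ` carrier Y" using pairs[OF _ v] by (metis imageE image_eqI)
  qed (use pb in \<open>auto simp: module_hom_closed\<close>)
  have "pd_le R n (ker_module Y P' pb)"
  proof (rule pd_le_iso[OF assms(9)])
    show "module R (ker_module Y P' pb)" by (rule module_ker_module[OF Y P' pb])
    have iY: "i \<in> module_hom R (ker_module P A f) Y"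
      unfolding Y_def using D(6,7) module_hom_zero[OF assms(7) P' A]
      by (intro module_hom_to_ker_module module_hom_from_ker_module D)
        (simp add: mem_a_kernel A.minus_eq_zero_iff)
    show i: "i \<in> module_hom R (ker_module P A f) (ker_module Y P' pb)"
      by (rule module_hom_to_ker_module[OF iY]) (simp add: D(7) mem_a_kernel)
    show "i ` carrier (ker_module P A f) = carrier (ker_module Y P' pb)"
    proof (intro equalityI subsetI)
      fix d assume "d \<in> carrier (ker_module Y P' pb)"
      then have d: "d \<in> carrier D" "pb d = \<zero>\<^bsub>P'\<^esub>" "f (pa d) = f' (pb d)"
        by (auto simp: mem_a_kernel memY)
      then have "d = i (pa d)"
        using D(10)[OF d(1)] module_hom_zero[OF D(3) P' D(1)] D(2,4)
        by (simp add: module_hom_closed)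
      moreover have "pa d \<in> carrier (ker_module P A f)"
        using d D(4) module_hom_zero[OF assms(7) P' A] by (simp add: mem_a_kernel module_hom_closed)
      ultimately show "d \<in> i ` carrier (ker_module P A f)" by blast
    qed (use module_hom_closed[OF i] in auto)
    fix a assume "a \<in> carrier (ker_module P A f)" "i a = \<zero>\<^bsub>ker_module Y P' pb\<^esub>"
    then show "a = \<zero>\<^bsub>ker_module P A f\<^esub>"
      using D(6)[of a] module_hom_zero[OF D(4) D(1) P] by (simp add: mem_a_kernel)
  qed
  then have "pd_le R n Y"
    by (rule pd_le_extension[OF assms(1) Y assms(4) pb pb_surj])
  then have "pd_le R n (ker_module Y P pa)"
    by (rule pd_le_kernel[OF _ assms(3) pa pa_surj])
  then show ?thesis
  proof (rule pd_le_iso)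
    show "module R (ker_module P' A f')" by (rule module_ker_module[OF P' A assms(7)])
    show h: "pb \<in> module_hom R (ker_module Y P pa) (ker_module P' A f')"
      using module_hom_zero[OF assms(5) P A] pb
      by (intro module_hom_to_ker_module module_hom_from_ker_module) (auto simp: mem_a_kernel memY)
    show "pb ` carrier (ker_module Y P pa) = carrier (ker_module P' A f')"
    proof (intro equalityI subsetI)
      fix v assume "v \<in> carrier (ker_module P' A f')"
      then have v: "v \<in> carrier P'" "f \<zero>\<^bsub>P\<^esub> = f' v"
        using module_hom_zero[OF assms(5) P A] by (auto simp: mem_a_kernel)
      have "i \<zero>\<^bsub>P\<^esub> \<oplus>\<^bsub>D\<^esub> j v \<in> carrier (ker_module Y P pa)"
        using pairs[OF P.zero_closed v] by (simp add: mem_a_kernel)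
      then show "v \<in> pb ` carrier (ker_module Y P pa)"
        using pairs(3)[OF P.zero_closed v] by (metis image_eqI)
    qed (use module_hom_closed[OF h] in auto)
    fix d assume "d \<in> carrier (ker_module Y P pa)" "pb d = \<zero>\<^bsub>ker_module P' A f'\<^esub>"
    then show "d = \<zero>\<^bsub>ker_module Y P pa\<^esub>"
      using D(10)[of d] module_hom_zero[OF D(2) P D(1)] module_hom_zero[OF D(3) P' D(1)]
      by (simp add: mem_a_kernel memY)
  qed
qed

section \<open>From finite resolutions to the inductive bound\<close>

lemma projective_resolution_shift:
  assumes "projective_resolution R M P d" "module R M"
  shows "projective_resolution R (ker_module (P 0) M (d 0)) (\<lambda>i. P (Suc i)) (\<lambda>i. d (Suc i))"
proof -
  note res = assms(1)[unfolded projective_resolution_def]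
  have "d 1 u \<in> a_kernel (P 0) M (d 0)" if "u \<in> carrier (P 1)" for u
    using res that by blast
  then have "d 1 \<in> module_hom R (P 1) (ker_module (P 0) M (d 0))"
    using res by (intro module_hom_to_ker_module) (auto simp: mem_a_kernel)
  moreover have "a_kernel (P 1) (ker_module (P 0) M (d 0)) (d 1) = a_kernel (P 1) (P 0) (d 1)"
    by (auto simp: mem_a_kernel)
  moreover have "d (Suc 1) ` carrier (P (Suc 1)) = a_kernel (P 1) (P 0) (d 1)"
    using res by (metis One_nat_def)
  ultimately show ?thesis
    using res unfolding projective_resolution_def by simp
qed

text \<open>Dropping the term \<open>P 0\<close> leaves a resolution of the first syzygy that is
  shorter by one, which matches the recursion of \<open>pd_le\<close>.\<close>

lemma pd_le_resolution:
  assumes "projective_resolution R M P d" "module R M" "\<forall>i>n. carrier (P i) = {\<zero>\<^bsub>P i\<^esub>}"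
  shows "pd_le R n M"
  using assms
proof (induction n arbitrary: M P d)
  case 0
  note res = 0(1)[unfolded projective_resolution_def]
  \<comment> \<open>As \<open>P 1\<close> vanishes, exactness at \<open>P 0\<close> makes the
    augmentation injective, so it is an isomorphism from \<open>P 0\<close> to
    \<open>M\<close>.\<close>
  have "a_kernel (P 0) M (d 0) = {d 1 \<zero>\<^bsub>P 1\<^esub>}"
    using res 0(3) by (metis image_empty image_insert less_numeral_extra(1))
  also have "d 1 \<zero>\<^bsub>P 1\<^esub> = \<zero>\<^bsub>P 0\<^esub>"
    using res by (metis One_nat_def module_hom_zero projective_moduleD)
  finally have "a_kernel (P 0) M (d 0) = {\<zero>\<^bsub>P 0\<^esub>}" .
  then have "a = \<zero>\<^bsub>P 0\<^esub>" if "a \<in> carrier (P 0)" "d 0 a = \<zero>\<^bsub>M\<^esub>" for a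
    using that by (metis mem_a_kernel singletonD)
  moreover have "pd_le R 0 (P 0)" "d 0 \<in> module_hom R (P 0) M" "d 0 ` carrier (P 0) = carrier M"
    using res by simp_all
  ultimately show ?case
    by (intro pd_le_iso[OF _ 0(2)])
next
  case (Suc n)
  note res = Suc.prems(1)[unfolded projective_resolution_def]
  have "pd_le R n (ker_module (P 0) M (d 0))"
  proof (rule Suc.IH[OF projective_resolution_shift[OF Suc.prems(1,2)]])
    show "module R (ker_module (P 0) M (d 0))"
      using res Suc.prems(2) by (intro module_ker_module) (auto intro: projective_moduleD)
  qed (use Suc.prems(3) in auto)
  then show ?case
    using res Suc.prems(2) by auto
qed

section \<open>Change of rings and free modules\<close>

definition restrict_scalars :: "('a \<Rightarrow> 's) \<Rightarrow> ('s, 'u) module \<Rightarrow> ('a, 'u) module" where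
  "restrict_scalars h M = \<lparr>carrier = carrier M, monoid.mult = monoid.mult M, one = monoid.one M,
     ring.zero = ring.zero M, ring.add = ring.add M, module.smult = (\<lambda>a u. h a \<odot>\<^bsub>M\<^esub> u)\<rparr>"

lemma restrict_scalars_simps [simp]:
  "carrier (restrict_scalars h M) = carrier M" "\<zero>\<^bsub>restrict_scalars h M\<^esub> = \<zero>\<^bsub>M\<^esub>"
  "u \<oplus>\<^bsub>restrict_scalars h M\<^esub> v = u \<oplus>\<^bsub>M\<^esub> v" "a \<odot>\<^bsub>restrict_scalars h M\<^esub> u = h a \<odot>\<^bsub>M\<^esub> u"
  by (simp_all add: restrict_scalars_def)

lemma a_kernel_restrict_scalars [simp]:
  "a_kernel (restrict_scalars h M) N f = a_kernel M N f"
  "a_kernel M (restrict_scalars h N) f = a_kernel M N f"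
  by (auto simp: mem_a_kernel)

lemma restrict_scalars_ker_module:
  "restrict_scalars h (ker_module M N f) = ker_module (restrict_scalars h M) (restrict_scalars h N) f"
  by (simp add: restrict_scalars_def a_kernel_def')

text \<open>The converse passage to \<open>restrict_scalars\<close>: a scalar of the target ring
  acts through a chosen preimage in \<open>R\<close>. The choice is harmless once the kernel of
  \<open>h\<close> annihilates \<open>A\<close>.\<close>

definition descend_scalars ::
    "('a, 'c) ring_scheme \<Rightarrow> ('a \<Rightarrow> 's) \<Rightarrow> ('a, 'u) module \<Rightarrow> ('s, 'u) module" where
  "descend_scalars R h A = \<lparr>carrier = carrier A, monoid.mult = monoid.mult A, one = monoid.one A,
     ring.zero = ring.zero A, ring.add = ring.add A,
     module.smult = (\<lambda>r u. inv_into (carrier R) h r \<odot>\<^bsub>A\<^esub> u)\<rparr>"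

lemma abelian_group_cong:
  assumes "abelian_group A" "carrier B = carrier A" "\<zero>\<^bsub>B\<^esub> = \<zero>\<^bsub>A\<^esub>" "ring.add B = ring.add A"
  shows "abelian_group B"
proof -
  interpret A: abelian_group A by fact
  show ?thesis
  proof (rule abelian_groupI)
    fix u assume "u \<in> carrier B"
    then show "\<exists>v\<in>carrier B. v \<oplus>\<^bsub>B\<^esub> u = \<zero>\<^bsub>B\<^esub>"
      using assms by (intro bexI[of _ "\<ominus>\<^bsub>A\<^esub> u"]) (auto simp: A.l_neg)
  qed (auto simp: assms(2-4) A.a_ac)
qed

locale surj_ring_hom = R: cring R + S: cring S for R :: "('a, 'c) ring_scheme" and S :: "('s, 'e) ring_scheme" +
  fixes h :: "'a \<Rightarrow> 's"
  assumes hom: "h \<in> ring_hom R S" and surj: "h ` carrier R = carrier S"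
begin

lemma module_restrict_scalars:
  assumes "module S M"
  shows "module R (restrict_scalars h M)"
proof -
  interpret M: module S M by fact
  have "abelian_group (restrict_scalars h M)"
    by (rule abelian_group_cong[OF M.abelian_group_axioms]) (simp_all add: restrict_scalars_def)
  then show ?thesis
    using hom R.cring_axioms
    by (intro moduleI) (auto simp: ring_hom_closed ring_hom_add ring_hom_mult ring_hom_one
        M.smult_l_distr M.smult_r_distr M.smult_assoc1)
qed

text \<open>Every scalar of \<open>S\<close> is some \<open>h a\<close> by surjectivity, so
  linearity over \<open>R\<close> and over \<open>S\<close> coincide.\<close>

lemma module_hom_restrict_scalars:
  "f \<in> module_hom R (restrict_scalars h M) (restrict_scalars h N) \<longleftrightarrow> f \<in> module_hom S M N"
  unfolding module_hom_iff surj[symmetric] by simp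

lemma
  assumes "module R A"
    and ann: "\<And>a u. a \<in> carrier R \<Longrightarrow> h a = \<zero>\<^bsub>S\<^esub> \<Longrightarrow> u \<in> carrier A \<Longrightarrow> a \<odot>\<^bsub>A\<^esub> u = \<zero>\<^bsub>A\<^esub>"
  shows module_descend_scalars: "module S (descend_scalars R h A)"
    and descend_scalars_hom: "(\<lambda>u. u) \<in> module_hom R A (restrict_scalars h (descend_scalars R h A))"
proof -
  interpret A: module R A by fact
  interpret H: ring_hom_cring R S h by unfold_locales (rule hom)
  let ?D = "descend_scalars R h A"
  have [simp]: "carrier ?D = carrier A" "\<zero>\<^bsub>?D\<^esub> = \<zero>\<^bsub>A\<^esub>" "ring.add ?D = ring.add A"
    by (simp_all add: descend_scalars_def)
  \<comment> \<open>Two preimages of one scalar differ by an element of the kernel of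
    \<open>h\<close>, which annihilates \<open>u\<close>.\<close>
  have smult: "h a \<odot>\<^bsub>?D\<^esub> u = a \<odot>\<^bsub>A\<^esub> u" if a: "a \<in> carrier R" and u: "u \<in> carrier A" for a u
  proof -
    let ?b = "inv_into (carrier R) h (h a)"
    have b: "?b \<in> carrier R" "h ?b = h a"
      using a by (auto intro: inv_into_into f_inv_into_f)
    have "h (?b \<ominus>\<^bsub>R\<^esub> a) = \<zero>\<^bsub>S\<^esub>"
      using a b by (simp add: a_minus_def H.hom_add H.hom_a_inv S.r_neg)
    then have "(?b \<ominus>\<^bsub>R\<^esub> a) \<odot>\<^bsub>A\<^esub> u = \<zero>\<^bsub>A\<^esub>"
      using ann a b u by simp
    moreover have "(?b \<ominus>\<^bsub>R\<^esub> a) \<odot>\<^bsub>A\<^esub> u = ?b \<odot>\<^bsub>A\<^esub> u \<ominus>\<^bsub>A\<^esub> a \<odot>\<^bsub>A\<^esub> u"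
      using a b u by (simp add: a_minus_def A.smult_l_distr A.smult_l_minus)
    ultimately show ?thesis
      using a b u by (simp add: descend_scalars_def A.minus_eq_zero_iff)
  qed
  have ag: "abelian_group ?D"
    by (rule abelian_group_cong[OF A.abelian_group_axioms]) simp_all
  show "module S ?D"
  proof (rule moduleI[OF S.cring_axioms ag])
    fix r u assume "r \<in> carrier S" and u: "u \<in> carrier ?D"
    then obtain a where a: "a \<in> carrier R" "r = h a" using surj by blast
    then show "r \<odot>\<^bsub>?D\<^esub> u \<in> carrier ?D" using u by (simp add: smult)
    { fix v assume "v \<in> carrier ?D"
      then show "r \<odot>\<^bsub>?D\<^esub> (u \<oplus>\<^bsub>?D\<^esub> v) = r \<odot>\<^bsub>?D\<^esub> u \<oplus>\<^bsub>?D\<^esub> r \<odot>\<^bsub>?D\<^esub> v"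
        using a u by (simp add: smult A.smult_r_distr) }
    { fix t assume "t \<in> carrier S"
      then obtain b where b: "b \<in> carrier R" "t = h b" using surj by blast
      show "(r \<oplus>\<^bsub>S\<^esub> t) \<odot>\<^bsub>?D\<^esub> u = r \<odot>\<^bsub>?D\<^esub> u \<oplus>\<^bsub>?D\<^esub> t \<odot>\<^bsub>?D\<^esub> u"
        "(r \<otimes>\<^bsub>S\<^esub> t) \<odot>\<^bsub>?D\<^esub> u = r \<odot>\<^bsub>?D\<^esub> (t \<odot>\<^bsub>?D\<^esub> u)"
        using a b u smult[of "a \<oplus>\<^bsub>R\<^esub> b" u] smult[of "a \<otimes>\<^bsub>R\<^esub> b" u]
        by (simp_all add: smult A.smult_l_distr A.smult_assoc1) }
  next
    fix u assume "u \<in> carrier ?D"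
    then show "\<one>\<^bsub>S\<^esub> \<odot>\<^bsub>?D\<^esub> u = u"
      using smult[of "\<one>\<^bsub>R\<^esub>" u] ring_hom_one[OF hom] by simp
  qed
  show "(\<lambda>u. u) \<in> module_hom R A (restrict_scalars h ?D)"
    by (rule module_homI) (simp_all add: smult)
qed

end

text \<open>Division by \<open>x\<close>: since \<open>x\<close> acts injectively on
  \<open>F\<close>, the quotient of \<open>f a\<close> by \<open>x\<close> is unique, and linearity
  of the quotient can be checked after multiplying by \<open>x\<close>.\<close>

lemma module_hom_divide:
  assumes "module R A" "module R F" "x \<in> carrier R" "f \<in> module_hom R A F"
    and reg: "\<And>u. u \<in> carrier F \<Longrightarrow> x \<odot>\<^bsub>F\<^esub> u = \<zero>\<^bsub>F\<^esub> \<Longrightarrow> u = \<zero>\<^bsub>F\<^esub>"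
    and img: "\<And>a. a \<in> carrier A \<Longrightarrow> \<exists>u\<in>carrier F. f a = x \<odot>\<^bsub>F\<^esub> u"
  obtains \<psi> where "\<psi> \<in> module_hom R A F" "\<And>a. a \<in> carrier A \<Longrightarrow> x \<odot>\<^bsub>F\<^esub> \<psi> a = f a"
proof -
  interpret A: module R A by fact
  interpret F: module R F by fact
  note scale = module_hom_scale[OF assms(2,3)]
  have inj: "inj_on (\<lambda>u. x \<odot>\<^bsub>F\<^esub> u) (carrier F)"
    using module_hom_inj_on[OF assms(2,2) scale] reg by blast
  define \<psi> where "\<psi> a = (SOME u. u \<in> carrier F \<and> f a = x \<odot>\<^bsub>F\<^esub> u)" for a
  have \<psi>: "\<psi> a \<in> carrier F" "x \<odot>\<^bsub>F\<^esub> \<psi> a = f a" if "a \<in> carrier A" for a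
  proof -
    have "\<exists>u. u \<in> carrier F \<and> f a = x \<odot>\<^bsub>F\<^esub> u" using img[OF that] by blast
    from someI_ex[OF this] show "\<psi> a \<in> carrier F" "x \<odot>\<^bsub>F\<^esub> \<psi> a = f a"
      by (simp_all add: \<psi>_def)
  qed
  have "\<psi> \<in> module_hom R A F"
  proof (rule module_homI)
    fix u assume u: "u \<in> carrier A"
    then show "\<psi> u \<in> carrier F" by (rule \<psi>)
    show "\<psi> (u \<oplus>\<^bsub>A\<^esub> v) = \<psi> u \<oplus>\<^bsub>F\<^esub> \<psi> v" if v: "v \<in> carrier A" for v
    proof (rule inj_onD[OF inj])
      have "x \<odot>\<^bsub>F\<^esub> \<psi> (u \<oplus>\<^bsub>A\<^esub> v) = f (u \<oplus>\<^bsub>A\<^esub> v)" using u v by (intro \<psi>) simp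
      then show "x \<odot>\<^bsub>F\<^esub> \<psi> (u \<oplus>\<^bsub>A\<^esub> v) = x \<odot>\<^bsub>F\<^esub> (\<psi> u \<oplus>\<^bsub>F\<^esub> \<psi> v)"
        using u v \<psi> assms(3,4) by (simp add: module_hom_add F.smult_r_distr)
    qed (use u v \<psi> in simp_all)
    show "\<psi> (a \<odot>\<^bsub>A\<^esub> u) = a \<odot>\<^bsub>F\<^esub> \<psi> u" if a: "a \<in> carrier R" for a
    proof (rule inj_onD[OF inj])
      have "x \<odot>\<^bsub>F\<^esub> \<psi> (a \<odot>\<^bsub>A\<^esub> u) = f (a \<odot>\<^bsub>A\<^esub> u)" using u a by (intro \<psi>) simp
      also have "\<dots> = a \<odot>\<^bsub>F\<^esub> (x \<odot>\<^bsub>F\<^esub> \<psi> u)" using u a assms(4) \<psi> by (simp add: module_hom_smult)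
      also have "\<dots> = x \<odot>\<^bsub>F\<^esub> (a \<odot>\<^bsub>F\<^esub> \<psi> u)"
        using u a assms(3) \<psi>(1) by (simp add: F.smult_assoc1[symmetric] A.R.m_comm)
      finally show "x \<odot>\<^bsub>F\<^esub> \<psi> (a \<odot>\<^bsub>A\<^esub> u) = x \<odot>\<^bsub>F\<^esub> (a \<odot>\<^bsub>F\<^esub> \<psi> u)" .
    qed (use u a \<psi> in simp_all)
  qed
  with \<psi>(2) show thesis using that by blast
qed

section \<open>Free modules and their copies in the universe\<close>

text \<open>Iterating a pairing function codes lists injectively among those of equal length; the
  length itself, coded through \<open>\<iota>\<close>, is paired in front to separate the
  others.\<close>

lemma infinite_lists_inj:
  assumes "infinite (UNIV :: 'u set)"
  obtains e :: "'u list \<Rightarrow> 'u" where "inj e"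
proof -
  obtain \<pi> :: "'u \<times> 'u \<Rightarrow> 'u" where \<pi>: "inj \<pi>"
    using card_of_Times_same_infinite[OF assms] by (auto simp: card_of_ordIso[symmetric] bij_betw_def)
  obtain \<iota> :: "nat \<Rightarrow> 'u" where \<iota>: "inj \<iota>"
    using assms infinite_countable_subset by blast
  define e where "e us = foldr (\<lambda>u v. \<pi> (u, v)) us (\<iota> 0)" for us
  have e: "us = vs" if "length us = length vs" "e us = e vs" for us vs
    using that by (induction us vs rule: list_induct2) (auto simp: e_def dest: injD[OF \<pi>])
  have "inj (\<lambda>us. \<pi> (\<iota> (length us), e us))"
    by (rule injI) (auto dest!: injD[OF \<pi>] injD[OF \<iota>] intro: e)
  then show thesis by (rule that)
qed

definition free_module :: "('a, 'c) ring_scheme \<Rightarrow> 'b set \<Rightarrow> ('a, 'b \<Rightarrow> 'a) module" where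
  "free_module R B = \<lparr>carrier = {\<phi>. range \<phi> \<subseteq> carrier R \<and> finite {b. \<phi> b \<noteq> \<zero>\<^bsub>R\<^esub>} \<and> {b. \<phi> b \<noteq> \<zero>\<^bsub>R\<^esub>} \<subseteq> B},
     monoid.mult = undefined, one = undefined, ring.zero = (\<lambda>b. \<zero>\<^bsub>R\<^esub>),
     ring.add = (\<lambda>\<phi> \<psi> b. \<phi> b \<oplus>\<^bsub>R\<^esub> \<psi> b), module.smult = (\<lambda>a \<phi> b. a \<otimes>\<^bsub>R\<^esub> \<phi> b)\<rparr>"

lemma free_module_simps [simp]:
  "\<zero>\<^bsub>free_module R B\<^esub> = (\<lambda>b. \<zero>\<^bsub>R\<^esub>)" "\<phi> \<oplus>\<^bsub>free_module R B\<^esub> \<psi> = (\<lambda>b. \<phi> b \<oplus>\<^bsub>R\<^esub> \<psi> b)"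
  "a \<odot>\<^bsub>free_module R B\<^esub> \<phi> = (\<lambda>b. a \<otimes>\<^bsub>R\<^esub> \<phi> b)"
  by (simp_all add: free_module_def)

lemma free_module_carrierD:
  assumes "\<phi> \<in> carrier (free_module R B)"
  shows "\<phi> b \<in> carrier R" "finite {b. \<phi> b \<noteq> \<zero>\<^bsub>R\<^esub>}" "{b. \<phi> b \<noteq> \<zero>\<^bsub>R\<^esub>} \<subseteq> B"
  using assms by (auto simp: free_module_def)

lemma free_module_carrierI:
  assumes "\<And>b. \<phi> b \<in> carrier R" "finite U" "U \<subseteq> B" "\<And>b. b \<notin> U \<Longrightarrow> \<phi> b = \<zero>\<^bsub>R\<^esub>"
  shows "\<phi> \<in> carrier (free_module R B)"
proof -
  have "{b. \<phi> b \<noteq> \<zero>\<^bsub>R\<^esub>} \<subseteq> U" using assms(4) by blast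
  then show ?thesis
    using assms(1-3) finite_subset by (auto simp: free_module_def)
qed

lemma module_free_module:
  assumes "cring R"
  shows "module R (free_module R B)"
proof -
  interpret R: cring R by fact
  let ?F = "free_module R B"
  have add: "\<phi> \<oplus>\<^bsub>?F\<^esub> \<psi> \<in> carrier ?F" if "\<phi> \<in> carrier ?F" "\<psi> \<in> carrier ?F" for \<phi> \<psi>
    using free_module_carrierD[OF that(1)] free_module_carrierD[OF that(2)]
    by (intro free_module_carrierI[where U = "{b. \<phi> b \<noteq> \<zero>\<^bsub>R\<^esub>} \<union> {b. \<psi> b \<noteq> \<zero>\<^bsub>R\<^esub>}"]) auto
  have smult: "a \<odot>\<^bsub>?F\<^esub> \<phi> \<in> carrier ?F" if "a \<in> carrier R" "\<phi> \<in> carrier ?F" for a \<phi>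
    using free_module_carrierD[OF that(2)] that(1)
    by (intro free_module_carrierI[where U = "{b. \<phi> b \<noteq> \<zero>\<^bsub>R\<^esub>}"]) auto
  have ag: "abelian_group ?F"
  proof (rule abelian_groupI)
    fix \<phi> assume \<phi>: "\<phi> \<in> carrier ?F"
    then have "(\<ominus>\<^bsub>R\<^esub> \<one>\<^bsub>R\<^esub>) \<odot>\<^bsub>?F\<^esub> \<phi> \<oplus>\<^bsub>?F\<^esub> \<phi> = \<zero>\<^bsub>?F\<^esub>"
      using free_module_carrierD(1)[OF \<phi>] by (simp add: R.l_minus R.l_neg)
    then show "\<exists>\<psi>\<in>carrier ?F. \<psi> \<oplus>\<^bsub>?F\<^esub> \<phi> = \<zero>\<^bsub>?F\<^esub>"
      using smult[OF _ \<phi>, of "\<ominus>\<^bsub>R\<^esub> \<one>\<^bsub>R\<^esub>"] by blast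
  next
    show "\<zero>\<^bsub>?F\<^esub> \<in> carrier ?F" by (rule free_module_carrierI[where U = "{}"]) auto
  qed (use add in \<open>auto simp: free_module_carrierD(1) R.a_ac\<close>)
  then show ?thesis
    using assms smult
    by (intro moduleI) (auto simp: free_module_carrierD(1) R.l_distr R.r_distr R.m_assoc)
qed

text \<open>A finitely supported function is determined by its graph over the support. The points of
  this finite graph are coded in \<open>'u\<close> by \<open>\<pi>\<close>, listed in some order,
  and the list is coded by \<open>e\<close>.\<close>

lemma free_module_carrier_lepoll:
  assumes "infinite (UNIV :: 'u set)" "carrier R \<lesssim> (UNIV :: 'u set)"
  shows "carrier (free_module R (B :: 'u set)) \<lesssim> (UNIV :: 'u set)"
proof -
  obtain \<pi> :: "'u \<times> 'u \<Rightarrow> 'u" where \<pi>: "inj \<pi>"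
    using card_of_Times_same_infinite[OF assms(1)] by (auto simp: card_of_ordIso[symmetric] bij_betw_def)
  obtain c :: "'a \<Rightarrow> 'u" where c: "inj_on c (carrier R)"
    using assms(2) by (auto simp: lepoll_def)
  obtain e :: "'u list \<Rightarrow> 'u" where e: "inj e"
    using infinite_lists_inj[OF assms(1)] .
  define G where "G \<phi> = (\<lambda>b. \<pi> (b, c (\<phi> b))) ` {b. \<phi> b \<noteq> \<zero>\<^bsub>R\<^esub>}" for \<phi> :: "'u \<Rightarrow> 'a"
  define l where "l \<phi> = (SOME us. set us = G \<phi>)" for \<phi>
  have l: "set (l \<phi>) = G \<phi>" if "\<phi> \<in> carrier (free_module R B)" for \<phi>
  proof -
    have "finite (G \<phi>)" using free_module_carrierD(2)[OF that] by (simp add: G_def)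
    from someI_ex[OF finite_list[OF this]] show ?thesis by (simp add: l_def)
  qed
  have "inj_on (\<lambda>\<phi>. e (l \<phi>)) (carrier (free_module R B))"
  proof (rule inj_onI)
    fix \<phi> \<psi> assume mem: "\<phi> \<in> carrier (free_module R B)" "\<psi> \<in> carrier (free_module R B)"
      and "e (l \<phi>) = e (l \<psi>)"
    then have G: "G \<phi> = G \<psi>" using l injD[OF e] by metis
    \<comment> \<open>Equal graphs give agreement where the first function is nonzero. Exchanging
      the functions covers the support of the other one, and elsewhere both are zero.\<close>
    have half: "\<phi> b = \<psi> b"
      if "\<phi> b \<noteq> \<zero>\<^bsub>R\<^esub>" "G \<phi> = G \<psi>" "\<phi> \<in> carrier (free_module R B)" "\<psi> \<in> carrier (free_module R B)"
      for \<phi> \<psi> b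
    proof -
      have "\<pi> (b, c (\<phi> b)) \<in> G \<psi>" using that(1,2) by (auto simp: G_def)
      then have "c (\<phi> b) = c (\<psi> b)" by (auto simp: G_def dest!: injD[OF \<pi>])
      then show ?thesis
        using free_module_carrierD(1)[OF that(3)] free_module_carrierD(1)[OF that(4)] inj_onD[OF c]
        by blast
    qed
    show "\<phi> = \<psi>"
    proof
      fix b
      show "\<phi> b = \<psi> b"
        using half[OF _ G mem, of b] half[OF _ G[symmetric] mem(2,1), of b] by metis
    qed
  qed
  then show ?thesis unfolding lepoll_def by blast
qed

text \<open>The canonical map that turns a formal linear combination of elements of \<open>A\<close>
  into its value in \<open>A\<close>.\<close>

definition free_eval :: "('a, 'c) ring_scheme \<Rightarrow> ('a, 'b) module \<Rightarrow> ('b \<Rightarrow> 'a) \<Rightarrow> 'b" where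
  "free_eval R A \<phi> = (\<Oplus>\<^bsub>A\<^esub> b \<in> {b. \<phi> b \<noteq> \<zero>\<^bsub>R\<^esub>}. \<phi> b \<odot>\<^bsub>A\<^esub> b)"

lemma
  assumes "module R A"
  shows free_eval_hom: "free_eval R A \<in> module_hom R (free_module R (carrier A)) A"
    and free_eval_surj: "free_eval R A ` carrier (free_module R (carrier A)) = carrier A"
proof -
  interpret A: module R A by fact
  let ?F = "free_module R (carrier A)"
  interpret F: module R ?F by (rule module_free_module) (rule A.R.cring_axioms)
  \<comment> \<open>Summing over any finite set that contains the support gives the same value,
    which lets sums with different supports be compared.\<close>
  have eval: "free_eval R A \<phi> = (\<Oplus>\<^bsub>A\<^esub> b \<in> U. \<phi> b \<odot>\<^bsub>A\<^esub> b)"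
    if "\<And>b. \<phi> b \<in> carrier R" "finite U" "U \<subseteq> carrier A" "{b. \<phi> b \<noteq> \<zero>\<^bsub>R\<^esub>} \<subseteq> U" for \<phi> U
    unfolding free_eval_def using that by (intro A.add.finprod_mono_neutral_cong_left) auto
  have closed: "free_eval R A \<phi> \<in> carrier A" if "\<phi> \<in> carrier ?F" for \<phi>
    unfolding free_eval_def using free_module_carrierD[OF that] by (intro A.finsum_closed) auto
  show hom: "free_eval R A \<in> module_hom R ?F A"
  proof (rule module_homI)
    fix \<phi> assume \<phi>: "\<phi> \<in> carrier ?F"
    note \<phi>D = free_module_carrierD[OF \<phi>]
    show "free_eval R A \<phi> \<in> carrier A" by (rule closed[OF \<phi>])
    show "free_eval R A (\<phi> \<oplus>\<^bsub>?F\<^esub> \<psi>) = free_eval R A \<phi> \<oplus>\<^bsub>A\<^esub> free_eval R A \<psi>"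
      if \<psi>: "\<psi> \<in> carrier ?F" for \<psi>
    proof -
      note \<psi>D = free_module_carrierD[OF \<psi>]
      let ?U = "{b. \<phi> b \<noteq> \<zero>\<^bsub>R\<^esub>} \<union> {b. \<psi> b \<noteq> \<zero>\<^bsub>R\<^esub>}"
      have U: "finite ?U" "?U \<subseteq> carrier A" using \<phi>D \<psi>D by auto
      have "free_eval R A (\<phi> \<oplus>\<^bsub>?F\<^esub> \<psi>) = (\<Oplus>\<^bsub>A\<^esub> b \<in> ?U. (\<phi> \<oplus>\<^bsub>?F\<^esub> \<psi>) b \<odot>\<^bsub>A\<^esub> b)"
        using \<phi>D \<psi>D U by (intro eval) auto
      also have "\<dots> = (\<Oplus>\<^bsub>A\<^esub> b \<in> ?U. \<phi> b \<odot>\<^bsub>A\<^esub> b \<oplus>\<^bsub>A\<^esub> \<psi> b \<odot>\<^bsub>A\<^esub> b)"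
        using \<phi>D \<psi>D U by (intro A.finsum_cong') (auto simp: A.smult_l_distr subset_iff)
      also have "\<dots> = (\<Oplus>\<^bsub>A\<^esub> b \<in> ?U. \<phi> b \<odot>\<^bsub>A\<^esub> b) \<oplus>\<^bsub>A\<^esub> (\<Oplus>\<^bsub>A\<^esub> b \<in> ?U. \<psi> b \<odot>\<^bsub>A\<^esub> b)"
        using \<phi>D \<psi>D U by (intro A.finsum_addf) auto
      also have "\<dots> = free_eval R A \<phi> \<oplus>\<^bsub>A\<^esub> free_eval R A \<psi>"
        using \<phi>D \<psi>D U by (subst (1 2) eval[of _ ?U]) auto
      finally show ?thesis .
    qed
    show "free_eval R A (a \<odot>\<^bsub>?F\<^esub> \<phi>) = a \<odot>\<^bsub>A\<^esub> free_eval R A \<phi>" if a: "a \<in> carrier R" for a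
    proof -
      let ?U = "{b. \<phi> b \<noteq> \<zero>\<^bsub>R\<^esub>}"
      have "free_eval R A (a \<odot>\<^bsub>?F\<^esub> \<phi>) = (\<Oplus>\<^bsub>A\<^esub> b \<in> ?U. (a \<odot>\<^bsub>?F\<^esub> \<phi>) b \<odot>\<^bsub>A\<^esub> b)"
        using \<phi>D a by (intro eval) auto
      also have "\<dots> = (\<Oplus>\<^bsub>A\<^esub> b \<in> ?U. a \<odot>\<^bsub>A\<^esub> (\<phi> b \<odot>\<^bsub>A\<^esub> b))"
        using \<phi>D a by (intro A.finsum_cong') (auto simp: A.smult_assoc1 subset_iff)
      also have "\<dots> = a \<odot>\<^bsub>A\<^esub> free_eval R A \<phi>"
        unfolding free_eval_def using \<phi>D a by (intro A.finsum_smult_ldistr[symmetric]) auto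
      finally show ?thesis .
    qed
  qed
  show "free_eval R A ` carrier ?F = carrier A"
  proof (intro equalityI subsetI)
    fix u assume u: "u \<in> carrier A"
    let ?\<delta> = "\<lambda>b. if b = u then \<one>\<^bsub>R\<^esub> else \<zero>\<^bsub>R\<^esub>"
    have "free_eval R A ?\<delta> = (\<Oplus>\<^bsub>A\<^esub> b \<in> {u}. ?\<delta> b \<odot>\<^bsub>A\<^esub> b)"
      using u by (intro eval) auto
    also have "\<dots> = u" using u by simp
    finally show "u \<in> free_eval R A ` carrier ?F"
      using u by (intro image_eqI[of _ _ ?\<delta>] free_module_carrierI[of _ _ "{u}"]) auto
  qed (use closed in blast)
qed

text \<open>A section of the evaluation map embeds \<open>P\<close> in a free module, where
  \<open>x\<close> acts coordinatewise and hence injectively. Projectivity is tested only against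
  modules on \<open>'u\<close>, so the section is taken into a copy of the free module
  there.\<close>

lemma projective_regular:
  fixes P :: "('a, 'u) module"
  assumes "infinite (UNIV :: 'u set)" "carrier R \<lesssim> (UNIV :: 'u set)"
    and "projective_module R P" "non_zero_divisor R x"
    and "p \<in> carrier P" "x \<odot>\<^bsub>P\<^esub> p = \<zero>\<^bsub>P\<^esub>"
  shows "p = \<zero>\<^bsub>P\<^esub>"
proof -
  note P = projective_moduleD[OF assms(3)]
  interpret P: module R P by (rule P)
  let ?F = "free_module R (carrier P)"
  note F = module_free_module[OF P.R.cring_axioms, of "carrier P"]
  have x: "x \<in> carrier R" using assms(4) by (simp add: non_zero_divisor_def)
  obtain \<pi> :: "('u \<Rightarrow> 'a) \<Rightarrow> 'u" where \<pi>: "inj_on \<pi> (carrier ?F)"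
    using free_module_carrier_lepoll[OF assms(1,2)] by (auto simp: lepoll_def)
  note t = module_transport[OF F \<pi>]
  let ?k = "inv_into (carrier ?F) \<pi>"
  let ?g = "\<lambda>u. free_eval R P (?k u)"
  have g: "?g \<in> module_hom R (module_image \<pi> ?F) P"
    by (rule module_hom_comp[OF t(3) free_eval_hom[OF P]])
  have "?k ` carrier (module_image \<pi> ?F) = carrier ?F"
    unfolding module_image_simps by (rule inv_into_image_cancel[OF \<pi> order_refl])
  then have g_surj: "?g ` carrier (module_image \<pi> ?F) = carrier P"
    using free_eval_surj[OF P] by (metis image_image)
  obtain s where s: "s \<in> module_hom R P (module_image \<pi> ?F)" "\<And>p. p \<in> carrier P \<Longrightarrow> ?g (s p) = p"
    using projective_section[OF assms(3) t(1) g g_surj] by blast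
  have ks: "(\<lambda>p. ?k (s p)) \<in> module_hom R P ?F" by (rule module_hom_comp[OF s(1) t(3)])
  let ?\<phi> = "?k (s p)"
  have \<phi>: "?\<phi> \<in> carrier ?F" using module_hom_closed[OF ks assms(5)] .
  have "x \<odot>\<^bsub>?F\<^esub> ?\<phi> = \<zero>\<^bsub>?F\<^esub>"
    using module_hom_smult[OF ks x assms(5)] module_hom_zero[OF ks P F] assms(6) by simp
  then have "?\<phi> b = \<zero>\<^bsub>R\<^esub>" for b
    using assms(4) free_module_carrierD(1)[OF \<phi>, of b]
    by (simp add: fun_eq_iff non_zero_divisor_def)
  then have "?\<phi> = \<zero>\<^bsub>?F\<^esub>" by auto
  then show ?thesis
    using s(2)[OF assms(5)] module_hom_zero[OF free_eval_hom[OF P] F P] by simp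
qed

section \<open>Resolutions and the triviality of Ext\<close>

lemma projective_resolution_exists:
  fixes M :: "('s, 'u) module"
  assumes enough: "\<And>A :: ('s, 'u) module. module S A \<Longrightarrow>
      \<exists>(P :: ('s, 'u) module) f. projective_module S P \<and> f \<in> module_hom S P A \<and> f ` carrier P = carrier A"
    and M: "module S M"
  shows "\<exists>P d. projective_resolution S M P d"
proof -
  obtain Pc :: "('s, 'u) module \<Rightarrow> ('s, 'u) module" and fc where c: "\<And>A. module S A \<Longrightarrow>
      projective_module S (Pc A) \<and> fc A \<in> module_hom S (Pc A) A \<and> fc A ` carrier (Pc A) = carrier A"
    using enough by metis
  \<comment> \<open>\<open>Z i\<close> is the i-th syzygy of \<open>M\<close> with respect to the
    chosen covers.\<close>
  define Z where "Z = rec_nat M (\<lambda>_ A. ker_module (Pc A) A (fc A))"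
  define P where "P i = Pc (Z i)" for i
  define d where "d i = fc (Z i)" for i
  have Z0: "Z 0 = M" and ZSuc: "Z (Suc i) = ker_module (P i) (Z i) (d i)" for i
    by (simp_all add: Z_def P_def d_def)
  have Z: "module S (Z i)" for i
  proof (induction i)
    case (Suc i)
    then show ?case
      using c[OF Suc] projective_moduleD by (auto simp: ZSuc P_def d_def intro!: module_ker_module)
  qed (simp add: Z0 M)
  have P: "projective_module S (P i)" "d i \<in> module_hom S (P i) (Z i)" "d i ` carrier (P i) = carrier (Z i)" for i
    using c[OF Z[of i]] by (simp_all add: P_def d_def)
  have dSuc: "d (Suc i) \<in> module_hom S (P (Suc i)) (P i)" for i
    using P(2)[of "Suc i"] by (auto simp: ZSuc module_hom_iff mem_a_kernel)
  have img: "d (Suc i) ` carrier (P (Suc i)) = a_kernel (P i) (Z i) (d i)" for i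
    using P(3)[of "Suc i"] by (simp add: ZSuc)
  \<comment> \<open>\<open>Z (Suc i)\<close> has the same zero as the module \<open>P i\<close>
    containing it, so either may serve as codomain.\<close>
  moreover have "a_kernel (P (Suc i)) (Z (Suc i)) (d (Suc i)) = a_kernel (P (Suc i)) (P i) (d (Suc i))" for i
    by (auto simp: mem_a_kernel ZSuc)
  ultimately have "projective_resolution S M P d"
    unfolding projective_resolution_def using P dSuc Z0 by (metis One_nat_def)
  then show ?thesis by blast
qed

lemma projective_resolution_simps:
  assumes "projective_resolution R M P d"
  shows "projective_module R (P i)" "module R (P i)" "d 0 \<in> module_hom R (P 0) M"
    "d (Suc i) \<in> module_hom R (P (Suc i)) (P i)" "d 0 ` carrier (P 0) = carrier M"
    "d (Suc 0) ` carrier (P (Suc 0)) = a_kernel (P 0) M (d 0)"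
    "d (Suc (Suc i)) ` carrier (P (Suc (Suc i))) = a_kernel (P (Suc i)) (P i) (d (Suc i))"
  using assms by (auto simp: projective_resolution_def intro: projective_moduleD)

lemma proj_dim_leI:
  assumes "projective_resolution R M P d" "\<forall>i>n. carrier (P i) = {\<zero>\<^bsub>P i\<^esub>}"
  shows "proj_dim R M \<le> enat n"
  unfolding proj_dim_def using assms by (intro Inf_lower) blast

lemma proj_dim_projective:
  fixes B :: "('a, 'u) module"
  assumes "projective_module R B"
  shows "proj_dim R B \<le> enat 0"
proof -
  note B = projective_moduleD[OF assms]
  \<comment> \<open>The zero module, obtained as the kernel of the identity; it fills all positive
    degrees, because resolutions are indexed by all natural numbers.\<close>
  let ?Z = "ker_module B B (\<lambda>u. u)"
  interpret B: module R B by (rule B)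
  have kerB: "a_kernel B B (\<lambda>u. u) = {\<zero>\<^bsub>B\<^esub>}" by (auto simp: mem_a_kernel)
  have Z: "module R ?Z" by (rule module_ker_module[OF B B module_hom_id])
  have ZB: "(\<lambda>u. u) \<in> module_hom R ?Z B" by (rule module_hom_from_ker_module[OF module_hom_id])
  have "projective_module R ?Z"
    by (rule projective_retract[OF Z assms module_hom_to_ker_module[OF module_hom_zero_fun[OF B B]] ZB])
      (auto simp: mem_a_kernel)
  then have "projective_resolution R B (\<lambda>i. if i = 0 then B else ?Z) (\<lambda>i u. u)"
    using assms ZB module_hom_id[of R]
    by (auto simp: projective_resolution_def kerB mem_a_kernel)
  then show ?thesis
    by (rule proj_dim_leI) (simp add: kerB)
qed

section \<open>A criterion for trivial Ext\<close>

lemma trivial_group_self_factor: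
  assumes "group G"
  shows "trivial_group (G Mod carrier G)"
proof -
  interpret G: group G by fact
  have "group (G Mod carrier G)"
    using G.normal_self normal.factorgroup_is_group by blast
  moreover have "carrier (G Mod carrier G) = {\<one>\<^bsub>G Mod carrier G\<^esub>}"
    using G.coset_join2[OF _ G.subgroup_self]
    by (auto simp: FactGroup_def RCOSETS_def intro!: exI[of _ "\<one>\<^bsub>G\<^esub>"])
  ultimately show ?thesis by (simp add: trivial_group_def)
qed

text \<open>\<open>Ext\<close> is computed from a resolution picked by \<open>SOME\<close>. The
  existence assumption makes the pick a genuine resolution, and \<open>ext\<close>, demanded for all
  resolutions, then says that every cocycle is a coboundary. The quotient is a group modulo
  itself.\<close>

lemma Ext_trivialI:
  fixes M :: "('s, 'u) module" and N :: "('s, 'd) module"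
  assumes ex: "\<exists>P d. projective_resolution S M P d" and N: "module S N"
    and ext: "\<And>P d f. \<lbrakk>projective_resolution S M P d; f \<in> module_hom S (P (Suc j)) N;
        \<And>u. u \<in> carrier (P (Suc (Suc j))) \<Longrightarrow> f (d (Suc (Suc j)) u) = \<zero>\<^bsub>N\<^esub>\<rbrakk> \<Longrightarrow>
      \<exists>g\<in>module_hom S (P j) N. \<forall>u\<in>carrier (P (Suc j)). g (d (Suc j) u) = f u"
  shows "trivial_group (Ext S (Suc j) M N)"
proof -
  interpret N: module S N by fact
  obtain P d where Pd: "(SOME (P, d). projective_resolution S M P d) = (P, d)"
    by (cases "SOME (P, d). projective_resolution S M P d") auto
  have "\<exists>z. case z of (P, d) \<Rightarrow> projective_resolution S M P d"
    using ex by auto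
  from someI_ex[OF this]
  have res: "projective_resolution S M P d"
    by (simp only: Pd prod.case)
  have Pm: "module S (P i)" for i
    using res by (auto simp: projective_resolution_def intro: projective_moduleD)
  have d: "d (Suc i) \<in> module_hom S (P (Suc i)) (P i)" for i
    using res by (auto simp: projective_resolution_def)
  interpret P1: module S "P (Suc j)" by (rule Pm)
  let ?i = "Suc j"
  let ?G = "(Hom_group S (P ?i) N)\<lparr>carrier := Ext_cocycles S P d ?i N\<rparr>"
  have cocycle: "f \<in> Ext_cocycles S P d ?i N \<longleftrightarrow> f \<in> module_hom S (P ?i) N \<and>
      f \<in> extensional (carrier (P ?i)) \<and> (\<forall>u\<in>carrier (P (Suc ?i)). f (d (Suc ?i) u) = \<zero>\<^bsub>N\<^esub>)" for f
    by (auto simp: Ext_cocycles_def Hom_group_def compose_def fun_eq_iff restrict_def)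
  have neg_zero: "\<ominus>\<^bsub>N\<^esub> \<zero>\<^bsub>N\<^esub> = \<zero>\<^bsub>N\<^esub>"
    using N.r_neg[OF N.zero_closed] by simp
  have zero_mem: "(\<lambda>u\<in>carrier (P ?i). \<zero>\<^bsub>N\<^esub>) \<in> Ext_cocycles S P d ?i N"
    using module_hom_closed[OF d] by (auto simp: cocycle module_hom_iff)
  have add_mem: "(\<lambda>u\<in>carrier (P ?i). f u \<oplus>\<^bsub>N\<^esub> g u) \<in> Ext_cocycles S P d ?i N"
    if "f \<in> Ext_cocycles S P d ?i N" "g \<in> Ext_cocycles S P d ?i N" for f g
    using that module_hom_closed[OF d]
    by (auto simp: cocycle module_hom_iff N.smult_r_distr N.a_ac)
  have group: "group ?G"
  proof (rule groupI)
    fix f assume f: "f \<in> carrier ?G"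
    then have fh: "f \<in> module_hom S (P ?i) N" by (simp add: cocycle)
    let ?n = "\<lambda>u\<in>carrier (P ?i). \<ominus>\<^bsub>N\<^esub> f u"
    have "?n \<in> Ext_cocycles S P d ?i N"
      using f module_hom_closed[OF d]
      by (auto simp: cocycle module_hom_iff N.minus_add N.smult_r_minus neg_zero)
    moreover have "?n \<otimes>\<^bsub>?G\<^esub> f = \<one>\<^bsub>?G\<^esub>"
      using module_hom_closed[OF fh] by (auto simp: Hom_group_def N.l_neg fun_eq_iff restrict_def)
    ultimately show "\<exists>g\<in>carrier ?G. g \<otimes>\<^bsub>?G\<^esub> f = \<one>\<^bsub>?G\<^esub>" by auto
    show "\<one>\<^bsub>?G\<^esub> \<otimes>\<^bsub>?G\<^esub> f = f"
      using f module_hom_closed[OF fh]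
      by (auto simp: Hom_group_def cocycle fun_eq_iff restrict_def extensional_def)
    fix g k assume "g \<in> carrier ?G" "k \<in> carrier ?G"
    then show "f \<otimes>\<^bsub>?G\<^esub> g \<otimes>\<^bsub>?G\<^esub> k = f \<otimes>\<^bsub>?G\<^esub> (g \<otimes>\<^bsub>?G\<^esub> k)"
      using f by (auto simp: Hom_group_def cocycle module_hom_iff fun_eq_iff restrict_def N.a_assoc)
  qed (use zero_mem add_mem in \<open>auto simp: Hom_group_def\<close>)
  have "Ext_coboundaries S P d ?i N = Ext_cocycles S P d ?i N"
  proof (intro equalityI subsetI)
    fix f assume "f \<in> Ext_coboundaries S P d ?i N"
    then obtain g where g: "g \<in> module_hom S (P j) N" "f = compose (carrier (P ?i)) g (d ?i)"
      by (auto simp: Ext_coboundaries_def Hom_group_def)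
    have "d ?i (d (Suc ?i) u) = \<zero>\<^bsub>P j\<^esub>" if "u \<in> carrier (P (Suc ?i))" for u
    proof -
      have "d (Suc ?i) u \<in> a_kernel (P ?i) (P j) (d ?i)"
        using res that unfolding projective_resolution_def by blast
      then show ?thesis by (simp add: mem_a_kernel)
    qed
    then show "f \<in> Ext_cocycles S P d ?i N"
      using module_hom_comp[OF d g(1)] g module_hom_closed[OF d] module_hom_zero[OF g(1) Pm N]
      by (auto simp: cocycle compose_def module_hom_iff)
  next
    fix f assume f: "f \<in> Ext_cocycles S P d ?i N"
    then obtain g where g: "g \<in> module_hom S (P j) N" "\<forall>u\<in>carrier (P ?i). g (d ?i u) = f u"
      using ext[OF res, of f] by (auto simp: cocycle)
    \<comment> \<open>Elements of \<open>Hom_group\<close> are extensional, so the extension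
      \<open>g\<close> has to be restricted before it can witness a coboundary.\<close>
    let ?g = "restrict g (carrier (P j))"
    interpret Pj: module S "P j" by (rule Pm)
    have "?g \<in> carrier (Hom_group S (P j) N)"
      using g(1) by (auto simp: Hom_group_def module_hom_iff)
    moreover have "f = compose (carrier (P ?i)) ?g (d ?i)"
      using f g(2) module_hom_closed[OF d]
      by (auto simp: cocycle compose_def fun_eq_iff restrict_def extensional_def)
    ultimately show "f \<in> Ext_coboundaries S P d ?i N"
      by (auto simp: Ext_coboundaries_def)
  qed
  then show ?thesis
    using trivial_group_self_factor[OF group] by (simp add: Ext_def Pd)
qed

section \<open>Reduction modulo a regular element\<close>

locale regular_quotient = R: cring R for R :: "('a, 'c) ring_scheme" +
  fixes x :: 'a and m :: nat and universe :: "'u itself"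
  assumes infinite_universe: "infinite (UNIV :: 'u set)"
    and carrier_lepoll: "carrier R \<lesssim> (UNIV :: 'u set)"
    and gl_dim: "gl_dim universe R = enat m"
    and regular: "non_zero_divisor R x"
begin

abbreviation "S \<equiv> R Quot (PIdl\<^bsub>R\<^esub> x)"
abbreviation "h \<equiv> (\<lambda>a. PIdl\<^bsub>R\<^esub> x +>\<^bsub>R\<^esub> a)"
abbreviation "res M \<equiv> restrict_scalars h (M :: ('a set, 'u) module)"

lemma x_closed: "x \<in> carrier R"
  using regular by (simp add: non_zero_divisor_def)

lemma ideal: "ideal (PIdl\<^bsub>R\<^esub> x) R"
  by (rule R.cgenideal_ideal[OF x_closed])

sublocale H: surj_ring_hom R S h
proof (intro surj_ring_hom.intro surj_ring_hom_axioms.intro)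
  show "cring R" by (rule R.cring_axioms)
  show "cring S" by (rule ideal.quotient_is_cring[OF ideal R.cring_axioms])
  show "h \<in> ring_hom R S" by (rule ideal.rcos_ring_hom[OF ideal])
  show "h ` carrier R = carrier S" by (auto simp: FactRing_def A_RCOSETS_def' )
qed

lemma h_eq_zeroD: "a \<in> carrier R \<Longrightarrow> h a = \<zero>\<^bsub>S\<^esub> \<Longrightarrow> \<exists>b\<in>carrier R. a = b \<otimes>\<^bsub>R\<^esub> x"
  using abelian_subgroup.a_rcos_self[OF abelian_subgroupI3[OF ideal.axioms(1)[OF ideal] R.abelian_group_axioms], of a]
  by (auto simp: FactRing_def cgenideal_def)

lemma h_x: "h x = \<zero>\<^bsub>S\<^esub>"
  using R.cgenideal_self[OF x_closed]
    abelian_subgroup.a_rcos_const[OF abelian_subgroupI3[OF ideal.axioms(1)[OF ideal] R.abelian_group_axioms], of x]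
  by (simp add: FactRing_def)

lemma x_smult: "module S M \<Longrightarrow> u \<in> carrier M \<Longrightarrow> h x \<odot>\<^bsub>M\<^esub> u = \<zero>\<^bsub>M\<^esub>"
  by (simp add: h_x module.smult_l_null)

text \<open>The projective dimension of \<open>A\<close> is an infimum bounded by the finite global
  dimension, and such an infimum is attained by an actual resolution.\<close>

lemma finite_resolution:
  fixes A :: "('a, 'u) module"
  assumes "module R A"
  obtains P d where "projective_resolution R A P d" "\<forall>i>m. carrier (P i) = {\<zero>\<^bsub>P i\<^esub>}"
proof -
  let ?D = "{enat n | n. \<exists>P d. projective_resolution R A P d \<and> (\<forall>i>n. carrier (P i) = {\<zero>\<^bsub>P i\<^esub>})}"
  have "proj_dim R A \<le> gl_dim universe R"
    unfolding gl_dim_def using assms by (intro Sup_upper) blast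
  then have le: "Inf ?D \<le> enat m" by (simp add: gl_dim proj_dim_def)
  \<comment> \<open>The infimum of the empty set is infinite, against the bound \<open>m\<close>; a
    nonempty set of extended naturals contains its least element.\<close>
  have "?D \<noteq> {}"
  proof
    assume "?D = {}"
    then have "Inf ?D = \<infinity>" by (simp only: Inf_enat_def if_True simp_thms)
    with le show False by simp
  qed
  then have "Inf ?D \<in> ?D" unfolding Inf_enat_def by (metis (no_types, lifting) LeastI ex_in_conv)
  then obtain n P d where "Inf ?D = enat n" "projective_resolution R A P d"
      "\<forall>i>n. carrier (P i) = {\<zero>\<^bsub>P i\<^esub>}" by blast
  with le show thesis by (intro that[of P d]) auto
qed

lemma pd_le_gl_dim: "module R (A :: ('a, 'u) module) \<Longrightarrow> pd_le R m A"
  using finite_resolution pd_le_resolution by metis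

text \<open>The augmentation of a finite resolution is the required surjection. Minimality is not
  part of the word cover here.\<close>

lemma projective_cover:
  assumes "module R (A :: ('a, 'u) module)"
  obtains P :: "('a, 'u) module" and f where "projective_module R P" "f \<in> module_hom R P A"
    "f ` carrier P = carrier A"
  using finite_resolution[OF assms] unfolding projective_resolution_def by metis

lemma projective_regular':
  assumes "projective_module R (P :: ('a, 'u) module)" "p \<in> carrier P" "x \<odot>\<^bsub>P\<^esub> p = \<zero>\<^bsub>P\<^esub>"
  shows "p = \<zero>\<^bsub>P\<^esub>"
  using projective_regular[OF infinite_universe carrier_lepoll assms(1) regular assms(2,3)] .

section \<open>The functor sending \<open>P\<close> to \<open>P / x P\<close>\<close>

text \<open>\<open>B\<close> is a model of \<open>P / x P\<close> on the universe type, with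
  \<open>\<pi>\<close> the canonical map. A relation is used because any such model serves equally
  well; its last clause says that the kernel of \<open>\<pi>\<close> is \<open>x P\<close>.\<close>

definition reduction :: "('a, 'u) module \<Rightarrow> ('a set, 'u) module \<Rightarrow> ('u \<Rightarrow> 'u) \<Rightarrow> bool" where
  "reduction P B \<pi> \<longleftrightarrow> module S B \<and> \<pi> \<in> module_hom R P (res B) \<and> \<pi> ` carrier P = carrier B \<and>
     (\<forall>p\<in>carrier P. \<pi> p = \<zero>\<^bsub>B\<^esub> \<longleftrightarrow> (\<exists>q\<in>carrier P. p = x \<odot>\<^bsub>P\<^esub> q))"

lemma reductionD:
  assumes "reduction P B \<pi>"
  shows "module S B" "\<pi> \<in> module_hom R P (res B)" "\<pi> ` carrier P = carrier B"
    "p \<in> carrier P \<Longrightarrow> \<pi> p = \<zero>\<^bsub>B\<^esub> \<longleftrightarrow> (\<exists>q\<in>carrier P. p = x \<odot>\<^bsub>P\<^esub> q)"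
  using assms by (auto simp: reduction_def)

lemma reduction_exists:
  assumes "module R (P :: ('a, 'u) module)"
  shows "\<exists>B \<pi>. reduction P B \<pi>"
proof -
  interpret P: module R P by fact
  have "submodule ((\<lambda>q. x \<odot>\<^bsub>P\<^esub> q) ` carrier P) R P"
  proof (rule P.submoduleI)
    show "\<zero>\<^bsub>P\<^esub> \<in> (\<lambda>q. x \<odot>\<^bsub>P\<^esub> q) ` carrier P"
      using x_closed by (intro image_eqI[of _ _ "\<zero>\<^bsub>P\<^esub>"]) auto
    fix u assume "u \<in> (\<lambda>q. x \<odot>\<^bsub>P\<^esub> q) ` carrier P"
    then obtain p where p: "p \<in> carrier P" "u = x \<odot>\<^bsub>P\<^esub> p" by blast
    then show "\<ominus>\<^bsub>P\<^esub> u \<in> (\<lambda>q. x \<odot>\<^bsub>P\<^esub> q) ` carrier P"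
      using x_closed by (intro image_eqI[of _ _ "\<ominus>\<^bsub>P\<^esub> p"]) (auto simp: P.smult_r_minus)
    show "a \<odot>\<^bsub>P\<^esub> u \<in> (\<lambda>q. x \<odot>\<^bsub>P\<^esub> q) ` carrier P" if "a \<in> carrier R" for a
      using x_closed p that
      by (intro image_eqI[of _ _ "a \<odot>\<^bsub>P\<^esub> p"]) (auto simp: P.smult_assoc1[symmetric] R.m_comm)
    fix v assume "v \<in> (\<lambda>q. x \<odot>\<^bsub>P\<^esub> q) ` carrier P"
    then obtain q where q: "q \<in> carrier P" "v = x \<odot>\<^bsub>P\<^esub> q" by blast
    then show "u \<oplus>\<^bsub>P\<^esub> v \<in> (\<lambda>q. x \<odot>\<^bsub>P\<^esub> q) ` carrier P"
      using x_closed p by (intro image_eqI[of _ _ "p \<oplus>\<^bsub>P\<^esub> q"]) (auto simp: P.smult_r_distr)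
  qed (use x_closed in auto)
  then obtain Q :: "('a, 'u) module" and \<pi> where Q: "module R Q" "\<pi> \<in> module_hom R P Q"
    "\<pi> ` carrier P = carrier Q" "\<And>a. a \<in> carrier P \<Longrightarrow> \<pi> a = \<zero>\<^bsub>Q\<^esub> \<longleftrightarrow> a \<in> (\<lambda>q. x \<odot>\<^bsub>P\<^esub> q) ` carrier P"
    using quotient_module_exists[OF assms] by metis
  \<comment> \<open>Elements of the kernel of \<open>h\<close> are multiples of \<open>x\<close>, so
    they send \<open>P\<close> into the kernel of \<open>\<pi>\<close>; hence the scalar action
    descends to \<open>S\<close>.\<close>
  have ann: "a \<odot>\<^bsub>Q\<^esub> u = \<zero>\<^bsub>Q\<^esub>" if a: "a \<in> carrier R" "h a = \<zero>\<^bsub>S\<^esub>" and u: "u \<in> carrier Q" for a u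
  proof -
    obtain p where p: "p \<in> carrier P" "u = \<pi> p" using u Q(3) by blast
    obtain b where b: "b \<in> carrier R" "a = b \<otimes>\<^bsub>R\<^esub> x" using h_eq_zeroD[OF a] by blast
    have "a \<odot>\<^bsub>P\<^esub> p = x \<odot>\<^bsub>P\<^esub> (b \<odot>\<^bsub>P\<^esub> p)"
      using b p x_closed by (simp add: P.smult_assoc1[symmetric] R.m_comm)
    then have "\<pi> (a \<odot>\<^bsub>P\<^esub> p) = \<zero>\<^bsub>Q\<^esub>"
      using Q(4)[of "a \<odot>\<^bsub>P\<^esub> p"] a(1) b(1) p(1) x_closed by auto
    then show ?thesis using Q(2) a(1) p by (simp add: module_hom_smult)
  qed
  let ?B = "descend_scalars R h Q"
  have "module S ?B" "(\<lambda>u. u) \<in> module_hom R Q (res ?B)"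
    using H.module_descend_scalars[OF Q(1) ann] H.descend_scalars_hom[OF Q(1) ann] by simp_all
  moreover have "carrier ?B = carrier Q" "\<zero>\<^bsub>?B\<^esub> = \<zero>\<^bsub>Q\<^esub>"
    by (simp_all add: descend_scalars_def)
  ultimately have "reduction P ?B \<pi>"
    using module_hom_comp[OF Q(2), of "\<lambda>u. u" "res ?B"] Q(3,4) by (auto simp: reduction_def)
  then show ?thesis by blast
qed

text \<open>The adjunction between reduction and restriction of scalars: \<open>x\<close> kills
  \<open>N\<close>, so \<open>f\<close> kills \<open>x P\<close> and factors through
  \<open>B\<close>.\<close>

lemma reduction_factor:
  assumes "reduction P B \<pi>" "module R P" "module S N" "f \<in> module_hom R P (res N)"
  obtains g where "g \<in> module_hom S B N" "\<And>p. p \<in> carrier P \<Longrightarrow> g (\<pi> p) = f p"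
proof -
  note B = reductionD[OF assms(1)]
  have "f p = \<zero>\<^bsub>N\<^esub>" if p: "p \<in> carrier P" "\<pi> p = \<zero>\<^bsub>B\<^esub>" for p
  proof -
    obtain q where "q \<in> carrier P" "p = x \<odot>\<^bsub>P\<^esub> q" using B(4)[OF p(1)] p(2) by blast
    then show ?thesis
      using module_hom_smult[OF assms(4) x_closed] module_hom_closed[OF assms(4)] assms(3)
      by (simp add: x_smult)
  qed
  then show thesis
    using module_hom_factor[OF assms(2) H.module_restrict_scalars[OF B(1)]
        H.module_restrict_scalars[OF assms(3)] B(2) _ assms(4)] B(3) that
    by (auto simp: H.module_hom_restrict_scalars)
qed

text \<open>By adjunction the lifting problem over \<open>S\<close> is posed for \<open>P\<close>
  over \<open>R\<close>, solved there, and the solution factors through \<open>B\<close>.\<close>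

lemma reduction_projective:
  assumes "reduction P B \<pi>" "projective_module R P"
  shows "projective_module S B"
  unfolding projective_module_def
proof (intro conjI allI impI)
  note B = reductionD[OF assms(1)]
  show "module S B" by (rule B)
  fix U V :: "('a set, 'u) module" and g f
  assume U: "module S U" and V: "module S V" and g: "g \<in> module_hom S U V"
    and g_surj: "g ` carrier U = carrier V" and f: "f \<in> module_hom S B V"
  have "(\<lambda>p. f (\<pi> p)) \<in> module_hom R P (res V)"
    using f by (intro module_hom_comp[OF B(2)]) (simp add: H.module_hom_restrict_scalars)
  then obtain k where k: "k \<in> module_hom R P (res U)" "\<And>p. p \<in> carrier P \<Longrightarrow> g (k p) = f (\<pi> p)"
    using projective_lift[OF assms(2) H.module_restrict_scalars[OF U] H.module_restrict_scalars[OF V],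
        of g "\<lambda>p. f (\<pi> p)"] g g_surj
    by (auto simp: H.module_hom_restrict_scalars)
  obtain k' where k': "k' \<in> module_hom S B U" "\<And>p. p \<in> carrier P \<Longrightarrow> k' (\<pi> p) = k p"
    using reduction_factor[OF assms(1) projective_moduleD[OF assms(2)] U k(1)] by blast
  have "\<forall>b\<in>carrier B. g (k' b) = f b"
    using k(2) k'(2) B(3) by (metis imageE)
  then show "\<exists>k\<in>module_hom S B U. \<forall>b\<in>carrier B. g (k b) = f b" using k'(1) by blast
qed

text \<open>Cover the restriction of \<open>M\<close> over \<open>R\<close> and reduce the cover
  modulo \<open>x\<close>.\<close>

lemma enough_projectives:
  assumes "module S (M :: ('a set, 'u) module)"
  shows "\<exists>(P :: ('a set, 'u) module) f. projective_module S P \<and> f \<in> module_hom S P M \<and>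
    f ` carrier P = carrier M"
proof -
  obtain P :: "('a, 'u) module" and f where P: "projective_module R P" "f \<in> module_hom R P (res M)"
    "f ` carrier P = carrier M"
    using projective_cover[OF H.module_restrict_scalars[OF assms]] by auto
  obtain B \<pi> where B: "reduction P B \<pi>"
    using reduction_exists[OF projective_moduleD[OF P(1)]] by blast
  obtain g where g: "g \<in> module_hom S B M" "\<And>p. p \<in> carrier P \<Longrightarrow> g (\<pi> p) = f p"
    using reduction_factor[OF B projective_moduleD[OF P(1)] assms P(2)] by blast
  have "g ` carrier B = carrier M"
    using g(2) P(3) unfolding reductionD(3)[OF B, symmetric] image_image by simp
  then show ?thesis using reduction_projective[OF B P(1)] g(1) by blast
qed

lemma reduction_induced:
  assumes "reduction P B \<pi>" "reduction P' B' \<pi>'" "module R P" "f \<in> module_hom R P P'"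
  obtains g where "g \<in> module_hom S B B'" "\<And>p. p \<in> carrier P \<Longrightarrow> g (\<pi> p) = \<pi>' (f p)"
  using reduction_factor[OF assms(1,3) reductionD(1)[OF assms(2)]
      module_hom_comp[OF assms(4) reductionD(2)[OF assms(2)]]] by blast

text \<open>The hypothesis \<open>coker\<close> says that \<open>x\<close> acts injectively on the cokernel of \<open>v\<close>.\<close>

lemma reduction_exact:
  assumes U: "module R U" "reduction U BU \<pi>U" and V: "module R V" "reduction V BV \<pi>V"
    and W: "module R W" "reduction W BW \<pi>W"
    and u: "u \<in> module_hom R U V" and v: "v \<in> module_hom R V W"
    and exact: "u ` carrier U = a_kernel V W v"
    and coker: "\<And>w. w \<in> carrier W \<Longrightarrow> x \<odot>\<^bsub>W\<^esub> w \<in> v ` carrier V \<Longrightarrow> w \<in> v ` carrier V"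
    and u': "\<And>p. p \<in> carrier U \<Longrightarrow> u' (\<pi>U p) = \<pi>V (u p)"
    and v': "\<And>p. p \<in> carrier V \<Longrightarrow> v' (\<pi>V p) = \<pi>W (v p)"
  shows "u' ` carrier BU = a_kernel BV BW v'"
proof (intro equalityI subsetI)
  interpret V: module R V by fact
  interpret W: module R W by fact
  note BU = reductionD[OF U(2)] and BV = reductionD[OF V(2)] and BW = reductionD[OF W(2)]
  { fix b assume "b \<in> u' ` carrier BU"
    then obtain p where p: "p \<in> carrier U" "b = \<pi>V (u p)" using BU(3) u' by (metis imageE)
    have "u p \<in> a_kernel V W v" using p exact by blast
    then have "u p \<in> carrier V" "v (u p) = \<zero>\<^bsub>W\<^esub>" by (auto simp: mem_a_kernel)
    then show "b \<in> a_kernel BV BW v'"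
      using p v' module_hom_closed[OF BV(2)]
        module_hom_zero[OF BW(2) W(1) H.module_restrict_scalars[OF BW(1)]]
      by (auto simp: mem_a_kernel) }
  { fix b assume "b \<in> a_kernel BV BW v'"
    then have "b \<in> carrier BV" "v' b = \<zero>\<^bsub>BW\<^esub>" by (auto simp: mem_a_kernel)
    then obtain p where p: "p \<in> carrier V" "b = \<pi>V p" "\<pi>W (v p) = \<zero>\<^bsub>BW\<^esub>"
      using BV(3) v' by (metis imageE)
    then obtain w where w: "w \<in> carrier W" "v p = x \<odot>\<^bsub>W\<^esub> w"
      using BW(4) module_hom_closed[OF v] by blast
    then obtain q where q: "q \<in> carrier V" "w = v q" using coker p(1) by (metis imageI imageE)
    \<comment> \<open>Since \<open>v p\<close> equals \<open>v (x q)\<close>, subtracting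
      \<open>x q\<close> moves \<open>p\<close> into the kernel of \<open>v\<close>, and the class
      of \<open>p\<close> modulo \<open>x\<close> is unchanged.\<close>
    let ?r = "p \<ominus>\<^bsub>V\<^esub> x \<odot>\<^bsub>V\<^esub> q"
    have xq: "x \<odot>\<^bsub>V\<^esub> q \<in> carrier V" using q x_closed by simp
    have "v ?r = \<zero>\<^bsub>W\<^esub>"
      using p q w xq v V W x_closed by (simp add: module_hom_rules W.minus_eq_zero_iff)
    then have "?r \<in> u ` carrier U" using p xq by (simp add: exact mem_a_kernel)
    then obtain t where t: "t \<in> carrier U" "u t = ?r" by (metis imageE)
    interpret B: module R "res BV" by (rule H.module_restrict_scalars[OF BV(1)])
    have "\<pi>V ?r \<oplus>\<^bsub>res BV\<^esub> \<pi>V (x \<odot>\<^bsub>V\<^esub> q) = \<pi>V (?r \<oplus>\<^bsub>V\<^esub> x \<odot>\<^bsub>V\<^esub> q)"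
      using p xq by (intro module_hom_add[OF BV(2), symmetric]) simp_all
    also have "\<dots> = \<pi>V p" using p xq by (simp add: V.minus_add_cancel)
    finally have "\<pi>V ?r \<oplus>\<^bsub>res BV\<^esub> \<pi>V (x \<odot>\<^bsub>V\<^esub> q) = b" using p by simp
    moreover have "\<pi>V (x \<odot>\<^bsub>V\<^esub> q) = \<zero>\<^bsub>res BV\<^esub>" using BV(4)[OF xq] q by auto
    moreover have "\<pi>V ?r \<in> carrier (res BV)" using module_hom_closed[OF BV(2)] p xq by simp
    ultimately have "\<pi>V ?r = b" by (simp del: restrict_scalars_simps)
    then have "u' (\<pi>U t) = b" using u' t by simp
    moreover have "\<pi>U t \<in> carrier BU" using module_hom_closed[OF BU(2) t(1)] by simp
    ultimately show "b \<in> u' ` carrier BU" by blast }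
qed

lemma reduction_surj:
  assumes "reduction U BU \<pi>U" "reduction V BV \<pi>V" "u ` carrier U = carrier V"
    and "\<And>p. p \<in> carrier U \<Longrightarrow> u' (\<pi>U p) = \<pi>V (u p)"
  shows "u' ` carrier BU = carrier BV"
proof -
  have "u' ` \<pi>U ` carrier U = \<pi>V ` u ` carrier U"
    using assms(4) by (simp add: image_image)
  then show ?thesis
    using reductionD(3)[OF assms(1)] reductionD(3)[OF assms(2)] assms(3) by simp
qed

text \<open>As \<open>x\<close> acts injectively on \<open>K\<close> and on every
  \<open>P i\<close>, no homology appears when the resolution of \<open>K\<close> is reduced modulo
  \<open>x\<close>. The terms beyond \<open>n\<close> stay zero.\<close>

lemma reduction_resolution:
  fixes K :: "('a, 'u) module"
  assumes P: "projective_resolution R K P d" and K: "module R K" "reduction K BK \<pi>K"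
    and reg: "\<And>k. k \<in> carrier K \<Longrightarrow> x \<odot>\<^bsub>K\<^esub> k = \<zero>\<^bsub>K\<^esub> \<Longrightarrow> k = \<zero>\<^bsub>K\<^esub>"
    and zero: "\<forall>i>n. carrier (P i) = {\<zero>\<^bsub>P i\<^esub>}"
  shows "proj_dim S BK \<le> enat n"
proof -
  note P' = projective_resolution_simps[OF P]
  interpret K: module R K by fact
  obtain B \<pi> where B: "\<And>i. reduction (P i) (B i) (\<pi> i)"
    using reduction_exists[OF P'(2)] by metis
  obtain e0 where e0: "e0 \<in> module_hom S (B 0) BK" "\<And>p. p \<in> carrier (P 0) \<Longrightarrow> e0 (\<pi> 0 p) = \<pi>K (d 0 p)"
    using reduction_induced[OF B K(2) P'(2,3)] by blast
  have "\<exists>g. g \<in> module_hom S (B (Suc i)) (B i) \<and> (\<forall>p\<in>carrier (P (Suc i)). g (\<pi> (Suc i) p) = \<pi> i (d (Suc i) p))" for i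
    using reduction_induced[OF B B P'(2) P'(4)] by metis
  then obtain eS where eS: "\<And>i. eS i \<in> module_hom S (B (Suc i)) (B i)"
      "\<And>i p. p \<in> carrier (P (Suc i)) \<Longrightarrow> eS i (\<pi> (Suc i) p) = \<pi> i (d (Suc i) p)"
    by metis
  \<comment> \<open>This supplies the hypothesis \<open>coker\<close> of
    \<open>reduction_exact\<close> in higher degrees: the image of a differential is the kernel of
    the next map, whose target has no \<open>x\<close>-torsion. In the lowest degree the hypothesis
    holds because \<open>d 0\<close> is surjective.\<close>
  have ker: "w \<in> a_kernel V W f"
    if "w \<in> carrier V" "x \<odot>\<^bsub>V\<^esub> w \<in> a_kernel V W f" "f \<in> module_hom R V W"
      "\<And>k. k \<in> carrier W \<Longrightarrow> x \<odot>\<^bsub>W\<^esub> k = \<zero>\<^bsub>W\<^esub> \<Longrightarrow> k = \<zero>\<^bsub>W\<^esub>"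
    for w and f and V W :: "('a, 'u) module"
    using that module_hom_smult[OF that(3) x_closed that(1)] module_hom_closed[OF that(3,1)]
    by (auto simp: mem_a_kernel)
  let ?e = "\<lambda>i. case i of 0 \<Rightarrow> e0 | Suc j \<Rightarrow> eS j"
  have "projective_resolution S BK B ?e"
    unfolding projective_resolution_def
  proof (intro conjI allI)
    show "projective_module S (B i)" for i by (rule reduction_projective[OF B P'(1)])
    show "?e 0 ` carrier (B 0) = carrier BK"
      using reduction_surj[OF B K(2) P'(5)] e0(2) by simp
    show "?e 1 ` carrier (B 1) = a_kernel (B 0) BK (?e 0)"
      using reduction_exact[OF P'(2) B P'(2) B K P'(4) P'(3) P'(6) _ eS(2) e0(2)] P'(5) by simp
    show "?e (Suc (Suc i)) ` carrier (B (Suc (Suc i))) = a_kernel (B (Suc i)) (B i) (?e (Suc i))" for i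
    proof -
      have "w \<in> d (Suc i) ` carrier (P (Suc i))"
        if "w \<in> carrier (P i)" "x \<odot>\<^bsub>P i\<^esub> w \<in> d (Suc i) ` carrier (P (Suc i))" for w
      proof (cases i)
        case 0
        with that show ?thesis using ker[of w "P 0" K "d 0"] P'(3) reg by (simp add: P'(6))
      next
        case (Suc j)
        with that show ?thesis
          using ker[of w "P (Suc j)" "P j" "d (Suc j)"] P'(4) projective_regular'[OF P'(1)]
          by (simp add: P'(7))
      qed
      then show ?thesis
        using reduction_exact[OF P'(2) B P'(2) B P'(2) B P'(4) P'(4) P'(7) _ eS(2) eS(2)] by simp
    qed
  qed (use e0 eS in simp_all)
  moreover have "carrier (B i) = {\<zero>\<^bsub>B i\<^esub>}" if "i > n" for i
    using reductionD(2,3)[OF B[of i]] zero that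
      module_hom_zero[OF reductionD(2)[OF B[of i]] P'(2) H.module_restrict_scalars[OF reductionD(1)[OF B[of i]]]]
    by (metis image_empty image_insert restrict_scalars_simps(2))
  ultimately show ?thesis by (intro proj_dim_leI) auto
qed

section \<open>The exact sequence with both ends equal to \<open>M\<close>\<close>

text \<open>\<open>B1\<close> is the reduction of \<open>P 0\<close> and \<open>B2\<close> that of
  the first syzygy \<open>K\<close>. The map \<open>f0\<close> comes from the augmentation,
  \<open>f1\<close> from the inclusion of \<open>K\<close>, and \<open>f2\<close> sends
  \<open>d 0 p\<close> to the class of \<open>x p\<close>.\<close>

lemma SG_sequence:
  fixes M :: "('a set, 'u) module"
  assumes "1 \<le> m" "module S M"
  obtains B1 B2 :: "('a set, 'u) module" and f0 f1 f2 where "module S B1" "module S B2"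
    "proj_dim S B1 \<le> enat 0" "proj_dim S B2 \<le> enat (m - 1)"
    "f0 \<in> module_hom S B1 M" "f1 \<in> module_hom S B2 B1" "f2 \<in> module_hom S M B2"
    "f0 ` carrier B1 = carrier M" "f1 ` carrier B2 = a_kernel B1 M f0"
    "f2 ` carrier M = a_kernel B2 B1 f1" "inj_on f2 (carrier M)"
proof -
  note M = H.module_restrict_scalars[OF assms(2)]
  obtain P :: "nat \<Rightarrow> ('a, 'u) module" and d where P: "projective_resolution R (res M) P d"
      "\<forall>i>m. carrier (P i) = {\<zero>\<^bsub>P i\<^esub>}"
    using finite_resolution[OF M] .
  note P' = projective_resolution_simps[OF P(1)]
  define K where "K = ker_module (P 0) (res M) (d 0)"
  have K: "module R K" unfolding K_def by (rule module_ker_module[OF P'(2) M P'(3)])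
  interpret P0: module R "P 0" by (rule P'(2))
  interpret M: module S M by fact
  have memK: "k \<in> carrier K \<longleftrightarrow> k \<in> carrier (P 0) \<and> d 0 k = \<zero>\<^bsub>M\<^esub>" for k
    by (simp add: K_def mem_a_kernel)
  have K_ops [simp]: "\<zero>\<^bsub>K\<^esub> = \<zero>\<^bsub>P 0\<^esub>" "a \<odot>\<^bsub>K\<^esub> u = a \<odot>\<^bsub>P 0\<^esub> u" for a u by (simp_all add: K_def)
  obtain B \<pi> where B: "reduction (P 0) B \<pi>" using reduction_exists[OF P'(2)] by blast
  obtain BK \<pi>K where BK: "reduction K BK \<pi>K" using reduction_exists[OF K] by blast
  note B' = reductionD[OF B] and BK' = reductionD[OF BK]
  \<comment> \<open>Passing to \<open>K\<close> shortens the resolution from \<open>m\<close> to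
    \<open>m - 1\<close>, and \<open>x\<close> acts injectively on \<open>K\<close> as it does on
    \<open>P 0\<close>.\<close>
  have "projective_resolution R K (\<lambda>i. P (Suc i)) (\<lambda>i. d (Suc i))"
    unfolding K_def by (rule projective_resolution_shift[OF P(1) M])
  then have pdBK: "proj_dim S BK \<le> enat (m - 1)"
    by (rule reduction_resolution[OF _ K BK]) (use projective_regular'[OF P'(1)] P(2) memK assms(1) in auto)
  have pdB: "proj_dim S B \<le> enat 0"
    by (rule proj_dim_projective[OF reduction_projective[OF B P'(1)]])
  obtain f0 where f0: "f0 \<in> module_hom S B M" "\<And>p. p \<in> carrier (P 0) \<Longrightarrow> f0 (\<pi> p) = d 0 p"
    using reduction_factor[OF B P'(2) assms(2) P'(3)] by blast
  have incl: "(\<lambda>k. k) \<in> module_hom R K (P 0)"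
    unfolding K_def by (rule module_hom_from_ker_module[OF module_hom_id])
  obtain f1 where f1: "f1 \<in> module_hom S BK B" "\<And>k. k \<in> carrier K \<Longrightarrow> f1 (\<pi>K k) = \<pi> k"
    using reduction_induced[OF BK B K incl] by blast
  have xK: "x \<odot>\<^bsub>P 0\<^esub> p \<in> carrier K" if "p \<in> carrier (P 0)" for p
    using that x_closed module_hom_smult[OF P'(3) x_closed that] module_hom_closed[OF P'(3) that]
    by (simp add: memK x_smult[OF assms(2)])
  have "(\<lambda>p. x \<odot>\<^bsub>P 0\<^esub> p) \<in> module_hom R (P 0) K"
    using module_hom_scale[OF P'(2) x_closed] xK by (auto simp: module_hom_iff K_def)
  from module_hom_comp[OF this BK'(2)]
  have \<pi>x: "(\<lambda>p. \<pi>K (x \<odot>\<^bsub>P 0\<^esub> p)) \<in> module_hom R (P 0) (res BK)" .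
  \<comment> \<open>If \<open>d 0 p\<close> vanishes, then \<open>p\<close> lies in \<open>K\<close>
    and \<open>x p\<close> in \<open>x K\<close>, so the class of \<open>x p\<close> modulo
    \<open>x K\<close> depends on \<open>d 0 p\<close> alone.\<close>
  obtain f2 where f2: "f2 \<in> module_hom R (res M) (res BK)"
      "\<And>p. p \<in> carrier (P 0) \<Longrightarrow> f2 (d 0 p) = \<pi>K (x \<odot>\<^bsub>P 0\<^esub> p)"
  proof (rule module_hom_factor[OF P'(2) M H.module_restrict_scalars[OF BK'(1)] P'(3) P'(5) \<pi>x])
    fix p assume "p \<in> carrier (P 0)" "d 0 p = \<zero>\<^bsub>res M\<^esub>"
    then show "\<pi>K (x \<odot>\<^bsub>P 0\<^esub> p) = \<zero>\<^bsub>res BK\<^esub>"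
      using BK'(4)[OF xK] by (auto simp: memK)
  qed blast
  have M_img: "carrier M = d 0 ` carrier (P 0)" using P'(5) by simp
  show thesis
  proof (rule that[OF B'(1) BK'(1) pdB pdBK f0(1) f1(1)])
    show "f2 \<in> module_hom S M BK" using f2(1) by (simp add: H.module_hom_restrict_scalars)
    show "f0 ` carrier B = carrier M"
      using f0(2) unfolding B'(3)[symmetric] M_img image_image by simp
    show "f1 ` carrier BK = a_kernel B M f0"
    proof (intro equalityI subsetI)
      fix b assume "b \<in> f1 ` carrier BK"
      then obtain k where k: "k \<in> carrier K" "b = \<pi> k" using BK'(3) f1(2) by (metis imageE)
      then show "b \<in> a_kernel B M f0"
        using f0(2) module_hom_closed[OF B'(2)] by (auto simp: memK mem_a_kernel)
    next
      fix b assume "b \<in> a_kernel B M f0"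
      then have "b \<in> carrier B" "f0 b = \<zero>\<^bsub>M\<^esub>" by (auto simp: mem_a_kernel)
      then obtain p where "p \<in> carrier (P 0)" "b = \<pi> p" "d 0 p = \<zero>\<^bsub>M\<^esub>"
        using B'(3) f0(2) by (metis imageE)
      then show "b \<in> f1 ` carrier BK"
        using f1(2)[of p] module_hom_closed[OF BK'(2), of p] by (metis imageI memK restrict_scalars_simps(1))
    qed
    show "f2 ` carrier M = a_kernel BK B f1"
    proof (intro equalityI subsetI)
      fix b assume "b \<in> f2 ` carrier M"
      then obtain p where "p \<in> carrier (P 0)" "b = f2 (d 0 p)"
        unfolding M_img by blast
      then have p: "p \<in> carrier (P 0)" "b = \<pi>K (x \<odot>\<^bsub>P 0\<^esub> p)"
        using f2(2) by simp_all
      then show "b \<in> a_kernel BK B f1"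
        using f1(2)[OF xK] module_hom_closed[OF BK'(2) xK] B'(4)[of "x \<odot>\<^bsub>P 0\<^esub> p"] x_closed
        by (auto simp: mem_a_kernel)
    next
      fix b assume "b \<in> a_kernel BK B f1"
      then have "b \<in> carrier BK" "f1 b = \<zero>\<^bsub>B\<^esub>" by (auto simp: mem_a_kernel)
      then obtain k where k: "k \<in> carrier K" "b = \<pi>K k" "\<pi> k = \<zero>\<^bsub>B\<^esub>"
        using BK'(3) f1(2) by (metis imageE)
      \<comment> \<open>The kernel of \<open>f1\<close> consists of the classes of elements of
        \<open>K\<close> that lie in \<open>x P 0\<close>, which is the image of
        \<open>f2\<close>.\<close>
      then obtain p where "p \<in> carrier (P 0)" "k = x \<odot>\<^bsub>P 0\<^esub> p"
        using B'(4) by (auto simp: memK)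
      then show "b \<in> f2 ` carrier M"
        using f2(2) k unfolding M_img by (metis imageI)
    qed
    show "inj_on f2 (carrier M)"
    proof -
      have "inj_on f2 (carrier (res M))"
      proof (rule module_hom_inj_on[OF M H.module_restrict_scalars[OF BK'(1)] f2(1)])
        fix u assume "u \<in> carrier (res M)" "f2 u = \<zero>\<^bsub>res BK\<^esub>"
        then obtain p where p: "p \<in> carrier (P 0)" "u = d 0 p" "\<pi>K (x \<odot>\<^bsub>P 0\<^esub> p) = \<zero>\<^bsub>BK\<^esub>"
          using f2(2) M_img by auto
        then obtain k where k: "k \<in> carrier K" "x \<odot>\<^bsub>P 0\<^esub> p = x \<odot>\<^bsub>P 0\<^esub> k"
          using BK'(4)[OF xK] by auto
        \<comment> \<open>If \<open>x p\<close> lies in \<open>x K\<close>, cancelling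
          \<open>x\<close> puts \<open>p\<close> itself in \<open>K\<close>, so its image in
          \<open>M\<close> is zero.\<close>
        have "inj_on (\<lambda>p. x \<odot>\<^bsub>P 0\<^esub> p) (carrier (P 0))"
          using module_hom_inj_on[OF P'(2) P'(2) module_hom_scale[OF P'(2) x_closed]]
            projective_regular'[OF P'(1)] by blast
        then have "p = k" using k p(1) by (auto simp: memK inj_on_def)
        then show "u = \<zero>\<^bsub>res M\<^esub>" using p k by (simp add: memK)
      qed
      then show ?thesis by simp
    qed
  qed
qed

section \<open>Syzygies over the quotient and the vanishing of Ext\<close>

text \<open>
  A section of \<open>P / x P \<longrightarrow> T\<close> lifts to \<open>\<sigma> : P \<longrightarrow> P\<close>. On the kernel of \<open>w\<close> it is divisible by \<open>x\<close>, say
  \<open>\<sigma> = x \<psi>\<close>, so that \<open>l = (l - \<sigma> l) + x \<psi> l\<close> factors the identity of the kernel through \<open>P \<oplus> P\<close>.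
\<close>

lemma projective_cover_kernel:
  fixes P :: "('a, 'u) module" and T :: "('a set, 'u) module"
  assumes T: "projective_module S T" and P: "projective_module R P"
    and w: "w \<in> module_hom R P (res T)" "w ` carrier P = carrier T"
  shows "projective_module R (ker_module P (res T) w)"
proof -
  note PM = projective_moduleD[OF P] and TM = projective_moduleD[OF T]
  note rT = H.module_restrict_scalars[OF TM]
  interpret P: module R P by (rule PM)
  interpret rT: module R "res T" by (rule rT)
  obtain B \<pi> where B: "reduction P B \<pi>" using reduction_exists[OF PM] by blast
  note B' = reductionD[OF B]
  note rB = H.module_restrict_scalars[OF B'(1)]
  obtain wb where wb: "wb \<in> module_hom S B T" "\<And>p. p \<in> carrier P \<Longrightarrow> wb (\<pi> p) = w p"
    using reduction_factor[OF B PM TM w(1)] by blast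
  have "wb ` carrier B = carrier T"
    using wb(2) w(2) unfolding B'(3)[symmetric] image_image by simp
  then obtain s where s: "s \<in> module_hom S T B" "\<And>t. t \<in> carrier T \<Longrightarrow> wb (s t) = t"
    using projective_section[OF T B'(1) wb(1)] by blast
  have s': "s \<in> module_hom R (res T) (res B)" using s(1) by (simp add: H.module_hom_restrict_scalars)
  obtain \<sigma> where \<sigma>: "\<sigma> \<in> module_hom R P P" "\<And>p. p \<in> carrier P \<Longrightarrow> \<pi> (\<sigma> p) = s (w p)"
    using projective_lift[OF P PM rB B'(2) _ module_hom_comp[OF w(1) s']] B'(3) by auto
  let ?L = "ker_module P (res T) w"
  have L: "module R ?L" by (rule module_ker_module[OF PM rT w(1)])
  have w\<sigma>: "w (\<sigma> p) = w p" if "p \<in> carrier P" for p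
  proof -
    have "w (\<sigma> p) = wb (\<pi> (\<sigma> p))" using that module_hom_closed[OF \<sigma>(1)] by (simp add: wb(2))
    also have "\<dots> = w p" using that module_hom_closed[OF w(1) that] by (simp add: \<sigma>(2) s(2))
    finally show ?thesis .
  qed
  have \<phi>: "(\<lambda>p. p \<ominus>\<^bsub>P\<^esub> \<sigma> p) \<in> module_hom R P ?L"
  proof (rule module_hom_to_ker_module[OF module_hom_minus_fun[OF PM PM module_hom_id \<sigma>(1)]])
    fix p assume p: "p \<in> carrier P"
    then have "w (p \<ominus>\<^bsub>P\<^esub> \<sigma> p) = w p \<ominus>\<^bsub>res T\<^esub> w (\<sigma> p)"
      using module_hom_closed[OF \<sigma>(1)] by (intro module_hom_minus[OF w(1) PM rT])
    then show "w (p \<ominus>\<^bsub>P\<^esub> \<sigma> p) = \<zero>\<^bsub>res T\<^esub>"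
      using p module_hom_closed[OF w(1) p] by (simp add: w\<sigma> rT.minus_eq_zero_iff del: restrict_scalars_simps)
  qed
  obtain \<psi> where \<psi>: "\<psi> \<in> module_hom R ?L P" "\<And>l. l \<in> carrier ?L \<Longrightarrow> x \<odot>\<^bsub>P\<^esub> \<psi> l = \<sigma> l"
  proof (rule module_hom_divide[OF L PM x_closed module_hom_from_ker_module[OF \<sigma>(1)]])
    fix l assume "l \<in> carrier ?L"
    then have l: "l \<in> carrier P" "w l = \<zero>\<^bsub>T\<^esub>" by (auto simp: mem_a_kernel)
    then have "\<pi> (\<sigma> l) = \<zero>\<^bsub>B\<^esub>"
      using \<sigma>(2) module_hom_zero[OF s(1) TM B'(1)] by simp
    then show "\<exists>u\<in>carrier P. \<sigma> l = x \<odot>\<^bsub>P\<^esub> u"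
      using B'(4) module_hom_closed[OF \<sigma>(1) l(1)] by blast
  qed (use projective_regular'[OF P] in blast)+
  have j: "(\<lambda>p. x \<odot>\<^bsub>P\<^esub> p) \<in> module_hom R P ?L"
  proof (rule module_hom_to_ker_module[OF module_hom_scale[OF PM x_closed]])
    fix p assume p: "p \<in> carrier P"
    then show "w (x \<odot>\<^bsub>P\<^esub> p) = \<zero>\<^bsub>res T\<^esub>"
      using module_hom_smult[OF w(1) x_closed p] module_hom_closed[OF w(1) p] by (simp add: x_smult[OF TM])
  qed
  show ?thesis
  proof (rule projective_decomposition[OF L P P \<phi> j module_hom_from_ker_module[OF module_hom_id] \<psi>(1)])
    fix l assume l: "l \<in> carrier ?L"
    then have "l \<in> carrier P" by (simp add: mem_a_kernel)
    then show "(l \<ominus>\<^bsub>P\<^esub> \<sigma> l) \<oplus>\<^bsub>?L\<^esub> x \<odot>\<^bsub>P\<^esub> \<psi> l = l"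
      using \<psi>(2)[OF l] module_hom_closed[OF \<sigma>(1)] by (simp add: P.minus_add_cancel)
  qed
qed

text \<open>With a cover \<open>w\<close> of \<open>T\<close> over \<open>R\<close>, the kernel
  \<open>K\<close> of the composite from \<open>P\<close> to \<open>C\<close> maps onto the syzygy
  \<open>Z\<close> with kernel \<open>L\<close>, and \<open>L\<close> is projective by
  \<open>projective_cover_kernel\<close>. Since \<open>K\<close> has dimension at most
  \<open>n + 1\<close>, a cover of \<open>K\<close> gives a cover of \<open>Z\<close> whose kernel
  \<open>E\<close> is an extension of \<open>L\<close> by a module of dimension at most
  \<open>n\<close>.\<close>

lemma pd_le_syzygy:
  fixes T C :: "('a set, 'u) module"
  assumes T: "projective_module S T" and C: "module S C"
    and v: "v \<in> module_hom S T C" "v ` carrier T = carrier C"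
    and pd: "pd_le R (Suc (Suc n)) (res C)"
  shows "pd_le R (Suc n) (res (ker_module T C v))"
proof -
  note TM = projective_moduleD[OF T]
  note rT = H.module_restrict_scalars[OF TM] and rC = H.module_restrict_scalars[OF C]
  have v': "v \<in> module_hom R (res T) (res C)" using v(1) by (simp add: H.module_hom_restrict_scalars)
  obtain P0 :: "('a, 'u) module" and f0 where P0: "projective_module R P0" "f0 \<in> module_hom R P0 (res C)"
    "f0 ` carrier P0 = carrier (res C)" "pd_le R (Suc n) (ker_module P0 (res C) f0)"
    using pd unfolding pd_le.simps(2)[of R "Suc n"] by blast
  obtain P :: "('a, 'u) module" and w where P: "projective_module R P" "w \<in> module_hom R P (res T)" "w ` carrier P = carrier (res T)"
    using projective_cover[OF rT] .
  note PM = projective_moduleD[OF P(1)]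
  have vw: "(\<lambda>p. v (w p)) \<in> module_hom R P (res C)" by (rule module_hom_comp[OF P(2) v'])
  have "(\<lambda>p. v (w p)) ` carrier P = carrier (res C)"
    using P(3) v(2) by (simp add: image_image[symmetric])
  \<comment> \<open>The bound is known for the cover \<open>P0\<close> of \<open>C\<close>; Schanuel
    transfers it to the composite cover through \<open>T\<close>.\<close>
  note K_pd = schanuel[OF infinite_universe rC P0(1) P(1) P0(2,3) vw this P0(4)]
  define K where "K = ker_module P (res C) (\<lambda>p. v (w p))"
  define Z where "Z = ker_module (res T) (res C) v"
  define L where "L = ker_module P (res T) w"
  have L: "projective_module R L"
    unfolding L_def using projective_cover_kernel[OF T P(1,2)] P(3) by simp
  have K: "module R K" unfolding K_def by (rule module_ker_module[OF PM rC vw])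
  have Z: "module R Z" unfolding Z_def by (rule module_ker_module[OF rT rC v'])
  obtain P' :: "('a, 'u) module" and f' where P': "projective_module R P'" "f' \<in> module_hom R P' K"
    "f' ` carrier P' = carrier K" "pd_le R n (ker_module P' K f')"
    using K_pd unfolding pd_le.simps(2)[of R n] K_def[symmetric] by blast
  note P'M = projective_moduleD[OF P'(1)]
  have w_KZ: "w \<in> module_hom R K Z"
    unfolding K_def Z_def
    by (intro module_hom_to_ker_module module_hom_from_ker_module P) (simp add: mem_a_kernel)
  have w_surj: "w ` carrier K = carrier Z"
  proof (intro equalityI subsetI)
    fix z assume "z \<in> carrier Z"
    then have z: "z \<in> carrier T" "v z = \<zero>\<^bsub>C\<^esub>" by (auto simp: Z_def mem_a_kernel)
    then obtain p where "p \<in> carrier P" "z = w p" using P(3) by auto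
    with z show "z \<in> w ` carrier K" by (auto simp: K_def mem_a_kernel)
  qed (use module_hom_closed[OF w_KZ] in auto)
  let ?g = "\<lambda>p. w (f' p)"
  have g: "?g \<in> module_hom R P' Z" by (rule module_hom_comp[OF P'(2) w_KZ])
  have g_surj: "?g ` carrier P' = carrier Z"
    using P'(3) w_surj by (simp add: image_image[symmetric])
  define E where "E = ker_module P' Z ?g"
  have E: "module R E" unfolding E_def by (rule module_ker_module[OF P'M Z g])
  have zeros: "\<zero>\<^bsub>Z\<^esub> = \<zero>\<^bsub>T\<^esub>" "\<zero>\<^bsub>K\<^esub> = \<zero>\<^bsub>P\<^esub>" "\<zero>\<^bsub>L\<^esub> = \<zero>\<^bsub>P\<^esub>" by (simp_all add: Z_def K_def L_def)
  have f'K: "f' p \<in> carrier P" if "p \<in> carrier P'" for p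
    using module_hom_closed[OF P'(2) that] by (simp add: K_def mem_a_kernel)
  have f'_EL: "f' \<in> module_hom R E L"
    using P'(2) f'K by (auto simp: module_hom_iff E_def L_def K_def mem_a_kernel zeros)
  have f'_surj: "f' ` carrier E = carrier L"
  proof (intro equalityI subsetI)
    fix l assume "l \<in> carrier L"
    then have l: "l \<in> carrier P" "w l = \<zero>\<^bsub>T\<^esub>" by (auto simp: L_def mem_a_kernel)
    then have "l \<in> carrier K"
      using module_hom_zero[OF v' rT rC] by (simp add: K_def mem_a_kernel)
    then obtain p where "p \<in> carrier P'" "l = f' p" using P'(3) by blast
    with l show "l \<in> f' ` carrier E" by (auto simp: E_def mem_a_kernel zeros)
  qed (use module_hom_closed[OF f'_EL] in auto)
  have "a_kernel E L f' = a_kernel P' K f'"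
    using module_hom_zero[OF P(2) PM rT] by (auto simp: E_def mem_a_kernel zeros)
  then have "ker_module E L f' = ker_module P' K f'" by (simp add: E_def)
  then have "pd_le R n E"
    using pd_le_extension[OF infinite_universe E L f'_EL f'_surj] P'(4) by simp
  then have "pd_le R (Suc n) Z"
    using pd_le_SucI[OF Z P'(1) g g_surj] by (simp add: E_def)
  then show ?thesis by (simp add: Z_def restrict_scalars_ker_module)
qed

text \<open>The vanishing of the first Ext group of \<open>C\<close>, in the form of an extension
  property. The resolution of \<open>C\<close> over \<open>R\<close> has length one, and
  \<open>T\<close> is the pushout of \<open>Z\<close> and \<open>P\<close> along \<open>K\<close>; a
  map on \<open>T\<close> is thus a map on \<open>P\<close> that agrees with \<open>f\<close> on
  \<open>K\<close>.\<close>

lemma extend_from_syzygy: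
  fixes T C Q :: "('a set, 'u) module"
  assumes T: "module S T" and C: "module S C" and Q: "projective_module S Q"
    and v: "v \<in> module_hom S T C" "v ` carrier T = carrier C"
    and pd: "pd_le R (Suc 0) (res C)"
    and f: "f \<in> module_hom S (ker_module T C v) Q"
  shows "\<exists>g\<in>module_hom S T Q. \<forall>z\<in>carrier (ker_module T C v). g z = f z"
proof -
  note QM = projective_moduleD[OF Q]
  note rT = H.module_restrict_scalars[OF T] and rC = H.module_restrict_scalars[OF C]
    and rQ = H.module_restrict_scalars[OF QM]
  interpret rT: module R "res T" by (rule rT)
  interpret rC: module R "res C" by (rule rC)
  interpret rQ: module R "res Q" by (rule rQ)
  have v': "v \<in> module_hom R (res T) (res C)" using v(1) by (simp add: H.module_hom_restrict_scalars)
  define Z where "Z = ker_module (res T) (res C) v"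
  have Z: "module R Z" unfolding Z_def by (rule module_ker_module[OF rT rC v'])
  have memZ: "z \<in> carrier Z \<longleftrightarrow> z \<in> carrier T \<and> v z = \<zero>\<^bsub>C\<^esub>" for z by (simp add: Z_def mem_a_kernel)
  have fZ: "f \<in> module_hom R Z (res Q)"
    using f by (simp add: H.module_hom_restrict_scalars[symmetric] restrict_scalars_ker_module Z_def)
  obtain P :: "('a, 'u) module" and u where P: "projective_module R P" "u \<in> module_hom R P (res C)"
    "u ` carrier P = carrier (res C)" "projective_module R (ker_module P (res C) u)"
    using pd unfolding pd_le.simps by blast
  note PM = projective_moduleD[OF P(1)]
  interpret P: module R P by (rule PM)
  define K where "K = ker_module P (res C) u"
  have memK: "k \<in> carrier K \<longleftrightarrow> k \<in> carrier P \<and> u k = \<zero>\<^bsub>C\<^esub>" for k by (simp add: K_def mem_a_kernel)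
  have K: "projective_module R K" unfolding K_def by (rule P(4))
  obtain a where a: "a \<in> module_hom R P (res T)" "\<And>p. p \<in> carrier P \<Longrightarrow> v (a p) = u p"
    using projective_lift[OF P(1) rT rC v' _ P(2)] v(2) by auto
  have aK: "a \<in> module_hom R K Z"
    unfolding K_def Z_def using a
    by (intro module_hom_to_ker_module module_hom_from_ker_module) (auto simp: mem_a_kernel)
  obtain F :: "('a, 'u) module" and c where F: "projective_module R F" "c \<in> module_hom R F (res Q)" "c ` carrier F = carrier (res Q)"
    using projective_cover[OF rQ] .
  note FM = projective_moduleD[OF F(1)]
  interpret F: module R F by (rule FM)
  obtain B \<pi> where B: "reduction F B \<pi>" using reduction_exists[OF FM] by blast
  note B' = reductionD[OF B]
  note rB = H.module_restrict_scalars[OF B'(1)]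
  obtain cb where cb: "cb \<in> module_hom S B Q" "\<And>p. p \<in> carrier F \<Longrightarrow> cb (\<pi> p) = c p"
    using reduction_factor[OF B FM QM F(2)] by blast
  have "cb ` carrier B = carrier Q"
    using cb(2) F(3) unfolding B'(3)[symmetric] image_image by simp
  \<comment> \<open>Projectivity over \<open>S\<close> makes \<open>Q\<close> a direct summand of
    the reduction of \<open>F\<close>.\<close>
  then obtain s where s: "s \<in> module_hom S Q B" "\<And>q. q \<in> carrier Q \<Longrightarrow> cb (s q) = q"
    using projective_section[OF Q B'(1) cb(1)] by blast
  have s': "s \<in> module_hom R (res Q) (res B)" using s(1) by (simp add: H.module_hom_restrict_scalars)
  \<comment> \<open>The composite from \<open>K\<close> through \<open>Z\<close> and
    \<open>Q\<close> to the reduction of \<open>F\<close> lifts to \<open>F\<close>, because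
    \<open>K\<close> is projective.\<close>
  obtain k where k: "k \<in> module_hom R K F" "\<And>p. p \<in> carrier K \<Longrightarrow> \<pi> (k p) = s (f (a p))"
    using projective_lift[OF K FM rB B'(2) _ module_hom_comp[OF module_hom_comp[OF aK fZ] s']] B'(3)
    by auto
  have xK: "x \<odot>\<^bsub>P\<^esub> p \<in> carrier K" if "p \<in> carrier P" for p
    using that x_closed module_hom_smult[OF P(2) x_closed that] module_hom_closed[OF P(2) that]
    by (simp add: memK x_smult[OF C])
  have "(\<lambda>p. x \<odot>\<^bsub>P\<^esub> p) \<in> module_hom R P K"
    using module_hom_scale[OF PM x_closed] xK by (auto simp: module_hom_iff K_def)
  from module_hom_comp[OF this k(1)]
  have kx: "(\<lambda>p. k (x \<odot>\<^bsub>P\<^esub> p)) \<in> module_hom R P F" .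
  \<comment> \<open>As \<open>x\<close> kills \<open>T\<close>, the map \<open>a\<close> vanishes on
    \<open>x P\<close>, so \<open>k\<close> sends \<open>x P\<close> into \<open>x F\<close>, where
    division by \<open>x\<close> is possible.\<close>
  obtain k' where k': "k' \<in> module_hom R P F" "\<And>p. p \<in> carrier P \<Longrightarrow> x \<odot>\<^bsub>F\<^esub> k' p = k (x \<odot>\<^bsub>P\<^esub> p)"
  proof (rule module_hom_divide[OF PM FM x_closed kx])
    fix p assume p: "p \<in> carrier P"
    have "a (x \<odot>\<^bsub>P\<^esub> p) = \<zero>\<^bsub>Z\<^esub>"
      using module_hom_smult[OF a(1) x_closed p] module_hom_closed[OF a(1) p] x_smult[OF T]
      by (simp add: Z_def)
    then have "\<pi> (k (x \<odot>\<^bsub>P\<^esub> p)) = \<zero>\<^bsub>B\<^esub>"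
      using k(2)[OF xK[OF p]] module_hom_zero[OF fZ Z rQ] module_hom_zero[OF s(1) QM B'(1)] by simp
    then show "\<exists>q\<in>carrier F. k (x \<odot>\<^bsub>P\<^esub> p) = x \<odot>\<^bsub>F\<^esub> q"
      using B'(4) module_hom_closed[OF kx p] by blast
  qed (use projective_regular'[OF F(1)] in blast)+
  \<comment> \<open>On \<open>K\<close> itself \<open>k\<close> commutes with \<open>x\<close>, so
    dividing \<open>k (x p)\<close> by \<open>x\<close> returns \<open>k p\<close>: the map
    \<open>k'\<close> extends \<open>k\<close>.\<close>
  have k'K: "k' p = k p" if p: "p \<in> carrier K" for p
  proof -
    have pP: "p \<in> carrier P" using p by (simp add: memK)
    have "inj_on (\<lambda>p. x \<odot>\<^bsub>F\<^esub> p) (carrier F)"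
      using module_hom_inj_on[OF FM FM module_hom_scale[OF FM x_closed]] projective_regular'[OF F(1)]
      by blast
    moreover have "x \<odot>\<^bsub>F\<^esub> k' p = x \<odot>\<^bsub>F\<^esub> k p"
      using k'(2)[OF pP] module_hom_smult[OF k(1) x_closed p] by (simp add: K_def)
    ultimately show ?thesis
      using module_hom_closed[OF k'(1) pP] module_hom_closed[OF k(1) p] by (auto dest: inj_onD)
  qed
  let ?g0 = "\<lambda>p. c (k' p)"
  have g0: "?g0 \<in> module_hom R P (res Q)" by (rule module_hom_comp[OF k'(1) F(2)])
  have g0K: "?g0 p = f (a p)" if p: "p \<in> carrier K" for p
  proof -
    have "?g0 p = cb (\<pi> (k p))" using p k'K module_hom_closed[OF k(1) p] by (simp add: cb(2))
    also have "\<dots> = f (a p)"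
      using p module_hom_closed[OF module_hom_comp[OF aK fZ] p] by (simp add: k(2) s(2))
    finally show ?thesis .
  qed
  have incl: "(\<lambda>z. z) \<in> module_hom R Z (res T)"
    unfolding Z_def by (rule module_hom_from_ker_module[OF module_hom_id])
  \<comment> \<open>The pushout presentation: \<open>?\<rho>\<close> maps the sum of
    \<open>Z\<close> and \<open>P\<close> onto \<open>T\<close>, and \<open>?\<theta>\<close> has to
    vanish on its kernel in order to induce \<open>g\<close>.\<close>
  let ?D = "dsum Z P"
  let ?\<rho> = "\<lambda>y. fst y \<oplus>\<^bsub>res T\<^esub> a (snd y)"
  let ?\<theta> = "\<lambda>y. f (fst y) \<oplus>\<^bsub>res Q\<^esub> ?g0 (snd y)"
  have \<rho>: "?\<rho> \<in> module_hom R ?D (res T)" by (rule dsum_copair_hom[OF rT incl a(1)])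
  have \<theta>: "?\<theta> \<in> module_hom R ?D (res Q)" by (rule dsum_copair_hom[OF rQ fZ g0])
  have \<rho>_surj: "?\<rho> ` carrier ?D = carrier (res T)"
  proof (intro equalityI subsetI)
    fix t assume t: "t \<in> carrier (res T)"
    then have "v t \<in> u ` carrier P" using P(3) module_hom_closed[OF v'] by simp
    then obtain p where p: "p \<in> carrier P" "u p = v t" by (metis imageE)
    have ap: "a p \<in> carrier (res T)" by (rule module_hom_closed[OF a(1) p(1)])
    have "v (t \<ominus>\<^bsub>res T\<^esub> a p) = \<zero>\<^bsub>res C\<^esub>"
      using module_hom_minus[OF v' rT rC t ap] a(2)[OF p(1)] p module_hom_closed[OF v' t]
      by (simp add: rC.minus_eq_zero_iff del: restrict_scalars_simps)
    then have z: "t \<ominus>\<^bsub>res T\<^esub> a p \<in> carrier Z"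
      using t ap rT.minus_closed by (simp add: memZ)
    then show "t \<in> ?\<rho> ` carrier ?D"
      using p(1) rT.minus_add_cancel[OF t ap]
      by (intro image_eqI[of _ _ "(t \<ominus>\<^bsub>res T\<^esub> a p, p)"]) simp_all
  qed (use module_hom_closed[OF \<rho>] in blast)
  obtain g where g: "g \<in> module_hom R (res T) (res Q)" "\<And>y. y \<in> carrier ?D \<Longrightarrow> g (?\<rho> y) = ?\<theta> y"
  proof (rule module_hom_factor[OF module_dsum[OF Z PM] rT rQ \<rho> \<rho>_surj \<theta>])
    fix y assume y: "y \<in> carrier ?D" and \<rho>0: "?\<rho> y = \<zero>\<^bsub>res T\<^esub>"
    have z: "fst y \<in> carrier Z" and p: "snd y \<in> carrier P" using y by auto
    have zT: "fst y \<in> carrier (res T)" "v (fst y) = \<zero>\<^bsub>res C\<^esub>" using z by (simp_all add: memZ)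
    have ap: "a (snd y) \<in> carrier (res T)" by (rule module_hom_closed[OF a(1) p])
    have "v (?\<rho> y) = \<zero>\<^bsub>res C\<^esub> \<oplus>\<^bsub>res C\<^esub> u (snd y)"
      using module_hom_add[OF v' zT(1) ap] zT(2) a(2)[OF p] by simp
    \<comment> \<open>An element of the kernel of \<open>?\<rho>\<close> has its second component in
      \<open>K\<close>, where \<open>?g0\<close> agrees with the composite of \<open>f\<close> and
      \<open>a\<close>; linearity of \<open>f\<close> then gives zero.\<close>
    then have "u (snd y) = \<zero>\<^bsub>res C\<^esub>"
      using \<rho>0 module_hom_zero[OF v' rT rC] rC.l_zero[OF module_hom_closed[OF P(2) p]] by metis
    then have pK: "snd y \<in> carrier K" using p by (simp add: memK)
    have "?\<theta> y = f (fst y \<oplus>\<^bsub>Z\<^esub> a (snd y))"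
      using module_hom_add[OF fZ z module_hom_closed[OF aK pK]] g0K[OF pK] by simp
    also have "fst y \<oplus>\<^bsub>Z\<^esub> a (snd y) = \<zero>\<^bsub>Z\<^esub>" using \<rho>0 by (simp add: Z_def)
    also have "f \<zero>\<^bsub>Z\<^esub> = \<zero>\<^bsub>res Q\<^esub>" by (rule module_hom_zero[OF fZ Z rQ])
    finally show "?\<theta> y = \<zero>\<^bsub>res Q\<^esub>" .
  qed blast
  have "g z = f z" if z: "z \<in> carrier (ker_module T C v)" for z
  proof -
    have zZ: "z \<in> carrier Z" and zT: "z \<in> carrier (res T)" using z by (auto simp: memZ mem_a_kernel)
    have "g (z \<oplus>\<^bsub>res T\<^esub> a \<zero>\<^bsub>P\<^esub>) = f z \<oplus>\<^bsub>res Q\<^esub> ?g0 \<zero>\<^bsub>P\<^esub>"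
      using g(2)[of "(z, \<zero>\<^bsub>P\<^esub>)"] zZ by simp
    then show ?thesis
      using module_hom_zero[OF a(1) PM rT] module_hom_zero[OF g0 PM rQ] rT.r_zero[OF zT]
        rQ.r_zero[OF module_hom_closed[OF fZ zZ]] by metis
  qed
  moreover have "g \<in> module_hom S T Q" using g(1) by (simp add: H.module_hom_restrict_scalars)
  ultimately show ?thesis by blast
qed

text \<open>A cocycle in degree \<open>j + 1\<close> is a map on the syzygy
  \<open>Z (Suc j)\<close>, and it extends to \<open>T j\<close> once \<open>Z j\<close> has
  dimension at most one over \<open>R\<close>.\<close>

lemma Ext_trivial:
  fixes M Q :: "('a set, 'u) module"
  assumes "1 \<le> m" "m - 1 < i" "module S M" "projective_module S Q"
  shows "trivial_group (Ext S i M Q)"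
proof -
  obtain j where i: "i = Suc j" and j: "m - 1 \<le> j" using assms(2) by (cases i) auto
  note QM = projective_moduleD[OF assms(4)]
  have "trivial_group (Ext S (Suc j) M Q)"
  proof (rule Ext_trivialI)
    show "\<exists>P d. projective_resolution S M P d"
      by (rule projective_resolution_exists[OF enough_projectives assms(3)])
    show "module S Q" by (rule QM)
    fix T d f
    assume T: "projective_resolution S M T d" and f: "f \<in> module_hom S (T (Suc j)) Q"
      and f0: "\<And>u. u \<in> carrier (T (Suc (Suc j))) \<Longrightarrow> f (d (Suc (Suc j)) u) = \<zero>\<^bsub>Q\<^esub>"
    define Z where "Z = rec_nat M (\<lambda>i A. ker_module (T i) A (d i))"
    have Z0: "Z 0 = M" and ZSuc: "Z (Suc i) = ker_module (T i) (Z i) (d i)" for i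
      by (simp_all add: Z_def)
    have Z: "module S (Z i) \<and> projective_resolution S (Z i) (\<lambda>l. T (l + i)) (\<lambda>l. d (l + i))" for i
    proof (induction i)
      case (Suc i)
      then have IH: "module S (Z i)" "projective_resolution S (Z i) (\<lambda>l. T (l + i)) (\<lambda>l. d (l + i))" by auto
      show ?case
        using projective_resolution_shift[OF IH(2,1)] projective_resolution_simps(2,3)[OF IH(2)] IH(1)
          module_ker_module[OF projective_resolution_simps(2)[OF IH(2), of 0] IH(1)]
        by (simp add: ZSuc)
    qed (simp add: Z0 assms(3) T)
    have ZM: "module S (Z i)" for i using Z by blast
    note ZT = projective_resolution_simps[OF conjunct2[OF Z]]
    have dZ: "d i \<in> module_hom S (T i) (Z i)" "d i ` carrier (T i) = carrier (Z i)" for i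
      using ZT(3,5)[of i] by simp_all
    have TP: "projective_module S (T i)" for i using ZT(1)[of 0 i] by simp
    \<comment> \<open>The count starts \<open>m - 1\<close> places before \<open>j\<close>, where
      only the global bound \<open>m\<close> is available. Each further syzygy lowers the bound by
      one, so at \<open>t = m - 1\<close> the module \<open>Z j\<close> is reached with bound
      one.\<close>
    have pd: "pd_le R (m - t) (res (Z (j - (m - 1) + t)))" if "t < m" for t
      using that
    proof (induction t)
      case 0
      then show ?case using pd_le_gl_dim[OF H.module_restrict_scalars[OF ZM]] by simp
    next
      case (Suc t)
      let ?l = "j - (m - 1) + t"
      obtain n where n: "m - t = Suc (Suc n)" "m - Suc t = Suc n"
        using Suc.prems by (metis Suc_diff_Suc Suc_lessD)
      show ?case
        using pd_le_syzygy[OF TP ZM dZ, of n ?l] Suc n by (simp add: ZSuc)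
    qed
    have "pd_le R (Suc 0) (res (Z j))"
      using pd[of "m - 1"] assms(1) j by simp
    note extend = extend_from_syzygy[OF projective_moduleD[OF TP] ZM assms(4) dZ this]
    \<comment> \<open>By exactness the cocycle kills the kernel of \<open>d (Suc j)\<close>, hence
      it factors through the image \<open>Z (Suc j)\<close> inside \<open>T j\<close>.\<close>
    have "f u = \<zero>\<^bsub>Q\<^esub>" if "u \<in> carrier (T (Suc j))" "d (Suc j) u = \<zero>\<^bsub>Z (Suc j)\<^esub>" for u
    proof -
      have "u \<in> a_kernel (T (Suc j)) (Z (Suc j)) (d (Suc j))" using that by (simp add: mem_a_kernel)
      then have "u \<in> d (Suc (Suc j)) ` carrier (T (Suc (Suc j)))" using ZT(6)[of "Suc j"] by simp
      then show ?thesis using f0 by blast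
    qed
    then obtain f' where f': "f' \<in> module_hom S (Z (Suc j)) Q"
        "\<And>u. u \<in> carrier (T (Suc j)) \<Longrightarrow> f' (d (Suc j) u) = f u"
      using module_hom_factor[OF projective_moduleD[OF TP] ZM QM dZ f] by blast
    obtain g where g: "g \<in> module_hom S (T j) Q" "\<And>z. z \<in> carrier (Z (Suc j)) \<Longrightarrow> g z = f' z"
      using extend[of f'] f'(1) by (auto simp: ZSuc)
    have "g (d (Suc j) u) = f u" if "u \<in> carrier (T (Suc j))" for u
      using g(2)[OF module_hom_closed[OF dZ(1) that]] f'(2)[OF that] by simp
    then show "\<exists>g\<in>module_hom S (T j) Q. \<forall>u\<in>carrier (T (Suc j)). g (d (Suc j) u) = f u"
      using g(1) by blast
  qed
  then show ?thesis by (simp add: i)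
qed

section \<open>Assembling the (2, m - 1)-SG property\<close>

lemma SG_ring_quotient:
  assumes "1 \<le> m"
  shows "SG_ring universe 2 (m - 1) S"
  unfolding SG_ring_def
proof (intro conjI allI impI)
  show "cring S" by (rule H.S.cring_axioms)
  fix M :: "('a set, 'u) module" assume M: "module S M"
  obtain B1 B2 :: "('a set, 'u) module" and f0 f1 f2 where B: "module S B1" "module S B2"
    "proj_dim S B1 \<le> enat 0" "proj_dim S B2 \<le> enat (m - 1)"
    "f0 \<in> module_hom S B1 M" "f1 \<in> module_hom S B2 B1" "f2 \<in> module_hom S M B2"
    "f0 ` carrier B1 = carrier M" "f1 ` carrier B2 = a_kernel B1 M f0"
    "f2 ` carrier M = a_kernel B2 B1 f1" "inj_on f2 (carrier M)"
    by (rule SG_sequence[OF assms M]) (rule that)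
  \<comment> \<open>The list runs against the arrows: entry 0 is the copy of \<open>M\<close> at the
    right end, entry 3 the one at the left end.\<close>
  define Q where "Q i = [M, B1, B2, M] ! i" for i
  define f where "f i = [f0, f1, f2] ! i" for i
  have Q: "Q 0 = M" "Q (Suc 0) = B1" "Q (Suc (Suc 0)) = B2" "Q (Suc (Suc (Suc 0))) = M"
    and f: "f 0 = f0" "f (Suc 0) = f1" "f (Suc (Suc 0)) = f2"
    by (simp_all add: Q_def f_def)
  have 2: "(2 :: nat) = Suc (Suc 0)" by simp
  have "proj_dim S B1 \<le> enat (m - 1)" using B(3) by (metis enat_ord_simps(1) order_trans zero_le)
  then have mods: "\<forall>i\<in>{1..2}. module S (Q i) \<and> proj_dim S (Q i) \<le> enat (m - 1)"
    using B by (auto simp: 2 le_Suc_eq Q)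
  have homs: "\<forall>i\<le>2. f i \<in> module_hom S (Q (Suc i)) (Q i)"
    using B by (auto simp: 2 le_Suc_eq Q f)
  have exact: "\<forall>i<2. f (Suc i) ` carrier (Q (Suc (Suc i))) = a_kernel (Q (Suc i)) (Q i) (f i)"
    using B by (auto simp: 2 less_Suc_eq Q f)
  have seq: "\<exists>(Q :: nat \<Rightarrow> ('a set, 'u) module) f. Q 0 = M \<and> Q (Suc 2) = M \<and>
      (\<forall>i\<in>{1..2}. module S (Q i) \<and> proj_dim S (Q i) \<le> enat (m - 1)) \<and>
      (\<forall>i\<le>2. f i \<in> module_hom S (Q (Suc i)) (Q i)) \<and>
      inj_on (f 2) (carrier (Q (Suc 2))) \<and>
      (\<forall>i<2. f (Suc i) ` carrier (Q (Suc (Suc i))) = a_kernel (Q (Suc i)) (Q i) (f i)) \<and>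
      f 0 ` carrier (Q 1) = carrier (Q 0)"
    using B(8,11) mods homs exact by (intro exI[of _ Q] exI[of _ f]) (simp add: 2 Q f)
  show "SG_projective 2 (m - 1) S M"
    unfolding SG_projective_def by (intro conjI M seq allI impI Ext_trivial[OF assms _ M]) simp_all
qed

end

theorem proposition2p15:
  fixes R :: "('a, 'c) ring_scheme" and x :: 'a and m :: nat
  assumes "infinite (UNIV :: 'u set)" and "carrier R \<lesssim> (UNIV :: 'u set)"
    and "cring R"
    and "m \<ge> 1" and "gl_dim TYPE('u) R = enat m"
    and "non_zero_divisor R x"
  shows "SG_ring TYPE('u) 2 (m - 1) (R Quot (PIdl\<^bsub>R\<^esub> x))"
proof -
  interpret regular_quotient R x m "TYPE('u)"
    using assms by (intro regular_quotient.intro regular_quotient_axioms.intro)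
  show ?thesis by (rule SG_ring_quotient[OF assms(4)])
qed

end
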